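(* The minimal index, or equivalently the scalar dimension, of connected and super-extremal multi-matrix inclusions with finite-dimensional centers is multiplicative. That is, if $\mathcal{L}\subset\mathcal{N}\subset\mathcal{M}$ are multi-matrix algebras such that both $\mathcal{L}\subset\mathcal{N}$ and $\mathcal{N}\subset\mathcal{M}$ are connected and super-extremal, then the minimal index of $\mathcal{L}\subset\mathcal{M}$ is the product of the minimal indices of $\mathcal{L}\subset\mathcal{N}$ and $\mathcal{N}\subset\mathcal{M}$ (equivalently, the scalar dimension of $\mathcal{L}\subset\mathcal{M}$ is the product of the scalar dimensions of $\mathcal{L}\subset\mathcal{N}$ and $\mathcal{N}\subset\mathcal{M}$).
   Context: A multi-matrix algebra is a finite direct sum of full matrix algebras; inclusions are unital. $\mathcal{N}\subset\mathcal{M}$ is connected if $\mathcal{Z}(\mathcal{N})\cap\mathcal{Z}(\mathcal{M})=\mathbb{C}\mathbf{1}$. $E(\mathcal{M},\mathcal{N})$ is the set of normal faithful conditional expectations $\mathcal M\to\mathcal N$. For $E\in E(\mathcal{M},\mathcal{N})$, $E^{-1}$ is Kosaki's operator-valued weight from $\mathcal{N}'$ to $\mathcal{M}'$, determined by $d(\varphi\circ E)/d\psi=d\varphi/d(\psi\circ E^{-1})$ (spatial derivatives; $\varphi,\psi$ normal faithful semifinite weights on $\mathcal{N}$, $\mathcal{M}'$), $\mathrm{Ind}(E)=E^{-1}(\mathbf{1})\in\mathcal{Z}(\mathcal{M})$, and the dual expectation is $E'=\mathrm{Ind}(E)^{-1}E^{-1}\in E(\mathcal{N}',\mathcal{M}')$.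 The minimal index is the minimum of $\|\mathrm{Ind}(E)\|$ over $E(\mathcal M,\mathcal N)$; for connected inclusions it is attained at a unique $E^0$, the minimal expectation. The scalar dimension is the square root of the minimal index. The spherical state $\omega_s$ of a connected $\mathcal{N}\subset\mathcal{M}$ is the unique faithful state on $\mathcal{N}'\cap\mathcal{M}$ with $\omega_s=\omega_s\circ E^0=\omega_s\circ {E^0}'$ there. Markov trace: for a faithful normalized trace $\tau$ on $\mathcal{M}$, let $E_{\mathcal{N},\tau}$ be the $\tau$-preserving conditional expectation onto $\mathcal{N}$ and $e$ the corresponding Jones projection on $L^2(\mathcal{M},\tau)$. $\tau$ is a (normalized) Markov trace for $\mathcal{N}\subset\mathcal{M}$ of modulus $\beta$ if there is a trace $\tau_1$ on the basic construction generated by $\mathcal{M}$ and $e$ that extends $\tau$ and satisfies $\beta\,\tau_1(xe)=\tau(x)$, $x\in\mathcal{M}$. For connected multi-matrix inclusions the normalized Markov trace exists and is unique. The inclusion is extremal if $E^0=E_{\mathcal{N},\tau}$ for $\tau$ the normalized Markov trace, and super-extremal if in addition $\omega_s=\tau_{\restriction\mathcal{N}'\cap\mathcal{M}}$. *)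

theory Defs
  imports "HOL-Analysis.Analysis"
begin

text \<open>
  All algebras are unital star-subalgebras of the full matrix algebra over the finite-dimensional
  Hilbert space \<^typ>\<open>complex^'n\<close>; the scalar multiple \<open>c x\<close> of a matrix is written \<open>mat c ** x\<close>.
  Maps between algebras, and functionals on them, are total functions constrained only on their
  domain of definition. In finite dimension every positive map is normal and every semifinite
  weight (or operator-valued weight) is finite, i.e. the restriction of a positive linear map.
\<close>

type_synonym 'n cmat = "complex^'n^'n"

section \<open>Matrix algebras\<close>

text \<open>The library's \<^const>\<open>inner\<close> on \<^typ>\<open>complex^'n\<close> is only the real part of this.\<close>

definition cinner :: "complex^'n \<Rightarrow> complex^'n \<Rightarrow> complex" where
  "cinner \<xi> \<eta> = (\<Sum>i\<in>UNIV. cnj (\<xi> $ i) * \<eta> $ i)"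

definition mat_star :: "'n::finite cmat \<Rightarrow> 'n cmat" where
  "mat_star x = (\<chi> i j. cnj (x $ j $ i))"

definition psd :: "'n::finite cmat \<Rightarrow> bool" where
  "psd x \<longleftrightarrow> (\<forall>\<xi>. cinner \<xi> (x *v \<xi>) \<in> \<real>\<^sub>\<ge>\<^sub>0)"

definition op_norm :: "'n::finite cmat \<Rightarrow> real" where
  "op_norm x = onorm (\<lambda>\<xi>. x *v \<xi>)"

definition commutant :: "'n::finite cmat set \<Rightarrow> 'n cmat set" where
  "commutant A = {x. \<forall>a\<in>A. x ** a = a ** x}"

definition center :: "'n::finite cmat set \<Rightarrow> 'n cmat set" where
  "center A = A \<inter> commutant A"

text \<open>
  The direct sum of the \<open>d i \<times> d i\<close> full matrix algebras, \<open>i < k\<close>: the entry at \<open>(a, b)\<close> of the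
  \<open>i\<close>-th summand of \<open>x\<close> is \<open>x i a b\<close>, and out-of-range entries are 0.
\<close>

definition matrix_direct_sum :: "nat \<Rightarrow> (nat \<Rightarrow> nat) \<Rightarrow> (nat \<Rightarrow> nat \<Rightarrow> nat \<Rightarrow> complex) set" where
  "matrix_direct_sum k d = {x. \<forall>i a b. \<not> (i < k \<and> a < d i \<and> b < d i) \<longrightarrow> x i a b = 0}"

definition multi_matrix_algebra :: "'n::finite cmat set \<Rightarrow> bool" where
  "multi_matrix_algebra A \<longleftrightarrow>
     (\<exists>k d \<Phi>. (\<forall>i<k. 0 < d i) \<and> bij_betw \<Phi> (matrix_direct_sum k d) A \<and>
        (\<forall>x\<in>matrix_direct_sum k d. \<forall>y\<in>matrix_direct_sum k d.
           \<Phi> (\<lambda>i a b. x i a b + y i a b) = \<Phi> x + \<Phi> y \<and>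
           \<Phi> (\<lambda>i a b. \<Sum>c<d i. x i a c * y i c b) = \<Phi> x ** \<Phi> y) \<and>
        (\<forall>x\<in>matrix_direct_sum k d. \<forall>c.
           \<Phi> (\<lambda>i a b. c * x i a b) = mat c ** \<Phi> x) \<and>
        (\<forall>x\<in>matrix_direct_sum k d. \<Phi> (\<lambda>i a b. cnj (x i b a)) = mat_star (\<Phi> x)) \<and>
        \<Phi> (\<lambda>i a b. if i < k \<and> a < d i \<and> a = b then 1 else 0) = mat 1)"

definition connected_inclusion :: "'n::finite cmat set \<Rightarrow> 'n cmat set \<Rightarrow> bool" where
  "connected_inclusion N M \<longleftrightarrow> center N \<inter> center M = range mat"

section \<open>Functionals, operator-valued weights and conditional expectations\<close>

definition pos_functional :: "'n::finite cmat set \<Rightarrow> ('n cmat \<Rightarrow> complex) \<Rightarrow> bool" where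
  "pos_functional A \<phi> \<longleftrightarrow>
     (\<forall>x\<in>A. \<forall>y\<in>A. \<phi> (x + y) = \<phi> x + \<phi> y) \<and>
     (\<forall>x\<in>A. \<forall>c. \<phi> (mat c ** x) = c * \<phi> x) \<and>
     (\<forall>x\<in>A. \<phi> (mat_star x ** x) \<in> \<real>\<^sub>\<ge>\<^sub>0)"

definition faithful_functional :: "'n::finite cmat set \<Rightarrow> ('n cmat \<Rightarrow> complex) \<Rightarrow> bool" where
  "faithful_functional A \<phi> \<longleftrightarrow>
     pos_functional A \<phi> \<and> (\<forall>x\<in>A. \<phi> (mat_star x ** x) = 0 \<longrightarrow> x = 0)"

definition faithful_state :: "'n::finite cmat set \<Rightarrow> ('n cmat \<Rightarrow> complex) \<Rightarrow> bool" where
  "faithful_state A \<phi> \<longleftrightarrow> faithful_functional A \<phi> \<and> \<phi> (mat 1) = 1"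

definition faithful_tracial_state :: "'n::finite cmat set \<Rightarrow> ('n cmat \<Rightarrow> complex) \<Rightarrow> bool" where
  "faithful_tracial_state A \<tau> \<longleftrightarrow>
     faithful_state A \<tau> \<and> (\<forall>x\<in>A. \<forall>y\<in>A. \<tau> (x ** y) = \<tau> (y ** x))"

text \<open>Normal, semifinite and faithful operator-valued weights from \<open>A\<close> to its subalgebra \<open>B\<close>.\<close>

definition op_valued_weight ::
    "'n::finite cmat set \<Rightarrow> 'n cmat set \<Rightarrow> ('n cmat \<Rightarrow> 'n cmat) \<Rightarrow> bool" where
  "op_valued_weight A B T \<longleftrightarrow>
     (\<forall>x\<in>A. T x \<in> B) \<and>
     (\<forall>x\<in>A. \<forall>y\<in>A. T (x + y) = T x + T y) \<and>
     (\<forall>x\<in>A. \<forall>c. T (mat c ** x) = mat c ** T x) \<and>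
     (\<forall>x\<in>A. psd (T (mat_star x ** x))) \<and>
     (\<forall>x\<in>A. \<forall>b\<in>B. \<forall>c\<in>B. T (b ** x ** c) = b ** T x ** c) \<and>
     (\<forall>x\<in>A. T (mat_star x ** x) = 0 \<longrightarrow> x = 0)"

definition cond_expectations ::
    "'n::finite cmat set \<Rightarrow> 'n cmat set \<Rightarrow> ('n cmat \<Rightarrow> 'n cmat) set" where
  "cond_expectations M N = {E. op_valued_weight M N E \<and> E (mat 1) = mat 1}"

section \<open>Spatial derivatives and the index\<close>

text \<open>
  Connes' operator \<open>\<theta>\<^sup>\<psi>(\<xi>) = R R\<^sup>*\<close> in the commutant of \<open>B\<close>, where \<open>R z = z \<xi>\<close> maps the GNS space of
  \<open>(B, \<psi>)\<close>, i.e. \<open>B\<close> with inner product \<open>\<psi>(y\<^sup>* z)\<close>, to \<^typ>\<open>complex^'n\<close>. Below, \<open>y = R\<^sup>* \<eta>\<close>.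
\<close>

definition spatial_theta ::
    "'n::finite cmat set \<Rightarrow> ('n cmat \<Rightarrow> complex) \<Rightarrow> complex^'n \<Rightarrow> 'n cmat" where
  "spatial_theta B \<psi> \<xi> =
     (THE T. \<forall>\<eta>. \<exists>y\<in>B. T *v \<eta> = y *v \<xi> \<and>
        (\<forall>z\<in>B. cinner \<eta> (z *v \<xi>) = \<psi> (mat_star y ** z)))"

text \<open>
  \<open>d\<phi>/d\<psi>\<close> for \<open>\<psi>\<close> on \<open>B\<close> and \<open>\<phi>\<close> on the commutant of \<open>B\<close>, given by its quadratic form.
\<close>

definition spatial_derivative ::
    "'n::finite cmat set \<Rightarrow> ('n cmat \<Rightarrow> complex) \<Rightarrow> ('n cmat \<Rightarrow> complex) \<Rightarrow> 'n cmat" where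
  "spatial_derivative B \<phi> \<psi> =
     (THE D. \<forall>\<xi>. cinner \<xi> (D *v \<xi>) = \<phi> (spatial_theta B \<psi> \<xi>))"

text \<open>\<open>F = E\<^sup>-\<^sup>1\<close> on \<open>commutant N\<close>, for \<open>E \<in> cond_expectations M N\<close>.\<close>

definition kosaki_inverse ::
    "'n::finite cmat set \<Rightarrow> 'n cmat set \<Rightarrow> ('n cmat \<Rightarrow> 'n cmat) \<Rightarrow> ('n cmat \<Rightarrow> 'n cmat) \<Rightarrow> bool" where
  "kosaki_inverse N M E F \<longleftrightarrow>
     op_valued_weight (commutant N) (commutant M) F \<and>
     (\<forall>\<phi> \<psi>. faithful_functional N \<phi> \<longrightarrow> faithful_functional (commutant M) \<psi> \<longrightarrow>
        spatial_derivative (commutant M) (\<phi> \<circ> E) \<psi> =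
        spatial_derivative (commutant N) \<phi> (\<psi> \<circ> F))"

definition has_index ::
    "'n::finite cmat set \<Rightarrow> 'n cmat set \<Rightarrow> ('n cmat \<Rightarrow> 'n cmat) \<Rightarrow> 'n cmat \<Rightarrow> bool" where
  "has_index N M E X \<longleftrightarrow> (\<exists>F. kosaki_inverse N M E F \<and> X = F (mat 1))"

definition dual_expectation ::
    "'n::finite cmat set \<Rightarrow> 'n cmat set \<Rightarrow> ('n cmat \<Rightarrow> 'n cmat) \<Rightarrow> ('n cmat \<Rightarrow> 'n cmat) \<Rightarrow> bool" where
  "dual_expectation N M E E' \<longleftrightarrow>
     (\<exists>F. kosaki_inverse N M E F \<and>
        (\<forall>x\<in>commutant N. E' x = matrix_inv (F (mat 1)) ** F x))"

definition min_index :: "'n::finite cmat set \<Rightarrow> 'n cmat set \<Rightarrow> real" where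
  "min_index N M = (LEAST r. \<exists>E\<in>cond_expectations M N. \<exists>X. has_index N M E X \<and> r = op_norm X)"

definition scalar_dimension :: "'n::finite cmat set \<Rightarrow> 'n cmat set \<Rightarrow> real" where
  "scalar_dimension N M = sqrt (min_index N M)"

definition minimal_expectation ::
    "'n::finite cmat set \<Rightarrow> 'n cmat set \<Rightarrow> ('n cmat \<Rightarrow> 'n cmat) \<Rightarrow> bool" where
  "minimal_expectation N M E \<longleftrightarrow>
     E \<in> cond_expectations M N \<and> (\<exists>X. has_index N M E X \<and> op_norm X = min_index N M)"

text \<open>Used with \<open>E\<close> the minimal expectation.\<close>

definition spherical_state ::
    "'n::finite cmat set \<Rightarrow> 'n cmat set \<Rightarrow> ('n cmat \<Rightarrow> 'n cmat) \<Rightarrow> ('n cmat \<Rightarrow> complex) \<Rightarrow> bool" where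
  "spherical_state N M E \<omega> \<longleftrightarrow>
     faithful_state (commutant N \<inter> M) \<omega> \<and>
     (\<exists>E'. dual_expectation N M E E' \<and>
        (\<forall>x\<in>commutant N \<inter> M. \<omega> x = \<omega> (E x) \<and> \<omega> x = \<omega> (E' x)))"

section \<open>The basic construction and Markov traces\<close>

definition trace_preserving_expectation ::
    "'n::finite cmat set \<Rightarrow> 'n cmat set \<Rightarrow> ('n cmat \<Rightarrow> complex) \<Rightarrow> ('n cmat \<Rightarrow> 'n cmat) \<Rightarrow> bool" where
  "trace_preserving_expectation N M \<tau> E \<longleftrightarrow>
     E \<in> cond_expectations M N \<and> (\<forall>x\<in>M. \<tau> (E x) = \<tau> x)"

text \<open>
  \<open>L\<^sup>2(M, \<tau>)\<close> is \<open>M\<close> with inner product \<open>\<tau>(x\<^sup>* y)\<close>. Operators on it are functions that vanish outside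
  \<open>M\<close>, so that equality of operators is equality of functions. If \<open>E\<close> is the \<open>\<tau>\<close>-preserving
  expectation onto \<open>N\<close>, then the Jones projection acts on \<open>M\<close> as \<open>E\<close>.
\<close>

definition left_mult :: "'n::finite cmat set \<Rightarrow> 'n cmat \<Rightarrow> ('n cmat \<Rightarrow> 'n cmat)" where
  "left_mult M x = (\<lambda>y. if y \<in> M then x ** y else 0)"

definition jones_projection ::
    "'n::finite cmat set \<Rightarrow> ('n cmat \<Rightarrow> 'n cmat) \<Rightarrow> ('n cmat \<Rightarrow> 'n cmat)" where
  "jones_projection M E = (\<lambda>y. if y \<in> M then E y else 0)"

text \<open>
  The generators form a self-adjoint set containing the identity, so the algebra they generate is
  the von Neumann algebra they generate.
\<close>

inductive_set basic_construction ::
    "'n::finite cmat set \<Rightarrow> ('n cmat \<Rightarrow> 'n cmat) \<Rightarrow> ('n cmat \<Rightarrow> 'n cmat) set"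
  for M :: "'n cmat set" and e :: "'n cmat \<Rightarrow> 'n cmat" where
  left: "x \<in> M \<Longrightarrow> left_mult M x \<in> basic_construction M e"
| proj: "e \<in> basic_construction M e"
| add: "S \<in> basic_construction M e \<Longrightarrow> T \<in> basic_construction M e \<Longrightarrow>
    (\<lambda>y. S y + T y) \<in> basic_construction M e"
| scale: "S \<in> basic_construction M e \<Longrightarrow> (\<lambda>y. mat c ** S y) \<in> basic_construction M e"
| mult: "S \<in> basic_construction M e \<Longrightarrow> T \<in> basic_construction M e \<Longrightarrow>
    S \<circ> T \<in> basic_construction M e"

text \<open>In the last clause, \<open>S\<close> is the adjoint of \<open>T\<close> on \<open>L\<^sup>2(M, \<tau>)\<close>.\<close>

definition trace_on_basic_construction ::
    "'n::finite cmat set \<Rightarrow> ('n cmat \<Rightarrow> complex) \<Rightarrow> ('n cmat \<Rightarrow> 'n cmat) \<Rightarrow>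
     (('n cmat \<Rightarrow> 'n cmat) \<Rightarrow> complex) \<Rightarrow> bool" where
  "trace_on_basic_construction M \<tau> e \<tau>\<^sub>1 \<longleftrightarrow>
     (\<forall>S\<in>basic_construction M e. \<forall>T\<in>basic_construction M e.
        \<tau>\<^sub>1 (\<lambda>y. S y + T y) = \<tau>\<^sub>1 S + \<tau>\<^sub>1 T \<and> \<tau>\<^sub>1 (S \<circ> T) = \<tau>\<^sub>1 (T \<circ> S)) \<and>
     (\<forall>S\<in>basic_construction M e. \<forall>c. \<tau>\<^sub>1 (\<lambda>y. mat c ** S y) = c * \<tau>\<^sub>1 S) \<and>
     (\<forall>S\<in>basic_construction M e. \<forall>T\<in>basic_construction M e.
        (\<forall>x\<in>M. \<forall>y\<in>M. \<tau> (mat_star (S x) ** y) = \<tau> (mat_star x ** T y)) \<longrightarrow>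
        \<tau>\<^sub>1 (S \<circ> T) \<in> \<real>\<^sub>\<ge>\<^sub>0)"

definition markov_trace_of_modulus ::
    "'n::finite cmat set \<Rightarrow> 'n cmat set \<Rightarrow> real \<Rightarrow> ('n cmat \<Rightarrow> complex) \<Rightarrow> bool" where
  "markov_trace_of_modulus N M \<beta> \<tau> \<longleftrightarrow>
     faithful_tracial_state M \<tau> \<and>
     (\<exists>E e \<tau>\<^sub>1. trace_preserving_expectation N M \<tau> E \<and> e = jones_projection M E \<and>
        trace_on_basic_construction M \<tau> e \<tau>\<^sub>1 \<and>
        (\<forall>x\<in>M. \<tau>\<^sub>1 (left_mult M x) = \<tau> x \<and>
               of_real \<beta> * \<tau>\<^sub>1 (left_mult M x \<circ> e) = \<tau> x))"

definition normalized_markov_trace ::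
    "'n::finite cmat set \<Rightarrow> 'n cmat set \<Rightarrow> ('n cmat \<Rightarrow> complex) \<Rightarrow> bool" where
  "normalized_markov_trace N M \<tau> \<longleftrightarrow> (\<exists>\<beta>. markov_trace_of_modulus N M \<beta> \<tau>)"

section \<open>Extremality\<close>

text \<open>
  For connected inclusions \<open>\<tau>\<close>, \<open>E\<close> (on \<open>M\<close>) and \<open>\<omega>\<close> are unique, so the existential quantifiers
  below only name them.
\<close>

definition extremal_via ::
    "'n::finite cmat set \<Rightarrow> 'n cmat set \<Rightarrow> ('n cmat \<Rightarrow> complex) \<Rightarrow> ('n cmat \<Rightarrow> 'n cmat) \<Rightarrow> bool" where
  "extremal_via N M \<tau> E \<longleftrightarrow>
     normalized_markov_trace N M \<tau> \<and> minimal_expectation N M E \<and>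
     trace_preserving_expectation N M \<tau> E"

definition super_extremal :: "'n::finite cmat set \<Rightarrow> 'n cmat set \<Rightarrow> bool" where
  "super_extremal N M \<longleftrightarrow>
     (\<exists>\<tau> E \<omega>. extremal_via N M \<tau> E \<and> spherical_state N M E \<omega> \<and>
        (\<forall>x\<in>commutant N \<inter> M. \<omega> x = \<tau> x))"

end

theory Submission
  imports Defs
begin

text \<open>
  Let \<open>T\<close> and \<open>S\<close> be the traces of the left regular representations of \<open>M\<close> and \<open>N\<close>, so that
  \<open>T(1) = dim M\<close> and \<open>S(1) = dim N\<close>. For every \<open>E\<close> the positive functional \<open>S \<circ> E\<close> has a density \<open>k\<close>
  with respect to \<open>T\<close>, and evaluating spatial derivatives at \<open>S\<close> and the trace of the commutant
  gives \<open>E\<^sup>-\<^sup>1(x) = \<Sum> f\<^sub>i k\<^sup>-\<^sup>1 x f\<^sub>i\<^sup>*\<close> for suitably normalised matrix units \<open>f\<^sub>i\<close> of \<open>M\<close>. Since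
  \<open>T(k) = dim N\<close> and \<open>T(k\<^sup>-\<^sup>1) = T(Ind E)\<close>, the Cauchy-Schwarz inequality \<open>T(1)\<^sup>2 \<le> T(k) T(k\<^sup>-\<^sup>1)\<close>
  bounds \<open>\<parallel>Ind E\<parallel>\<close> from below by \<open>dim M / dim N\<close>, for every inclusion. Super-extremality forces \<open>k\<close> to be a
  scalar: the Markov property makes the index a scalar \<open>\<beta>\<close>, and \<open>\<tau> \<circ> E' = \<tau>\<close> on the relative
  commutant then gives \<open>k = \<beta>\<^sup>-\<^sup>1\<close>. Hence the minimal index of a super-extremal inclusion
  is \<open>dim M / dim N\<close>, and composing the two minimal expectations attains the lower bound for \<open>L \<subseteq> M\<close>.
\<close>

section \<open>Complex matrices\<close>

text \<open>The quotient \<open>dim M / dim N\<close> depends on the two algebras alone, so it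
  telescopes along \<open>L \<subseteq> N \<subseteq> M\<close>. For a general inclusion the minimal
  index can exceed it, and a composite of minimal expectations need not be minimal. The regular
  traces are the suitable reference functionals because scalar densities compose:
  \<open>R \<circ> E1 = (r / s) S\<close> and \<open>S \<circ> E2 = (s / t) T\<close> give
  \<open>R \<circ> E1 \<circ> E2 = (r / t) T\<close>. Kosaki's inverse is a relation quantified over
  all faithful \<open>\<phi>\<close> and \<open>\<psi>\<close>. One well-chosen pair already
  determines it; for the composite expectation the full relation is obtained by chaining the two
  given ones, which asks only that the intermediate functionals \<open>\<phi> \<circ> E1\<close> and
  \<open>\<psi> \<circ> F2\<close> be faithful. Commutants carry no chosen matrix units. Functionals
  on them are represented through the ambient matrix trace, with an average over the units of the
  algebra as projection onto its commutant.\<close>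

lemma mat_add: "mat (c + d) = mat c + mat (d :: complex)"
  by (vector mat_def)

lemma mat_mult: "mat c ** mat d = (mat (c * d) :: 'n::finite cmat)"
  by (simp add: matrix_matrix_mult_def mat_def vec_eq_iff if_distrib[of "\<lambda>x. x * _"] cong: if_cong)

lemma mat_component [simp]: "(mat c ** x) $ i $ j = c * (x :: 'n::finite cmat) $ i $ j"
  by (simp add: matrix_matrix_mult_def mat_def if_distrib[of "\<lambda>x. x * _"] cong: if_cong)

lemma mat_central: "x ** mat c = mat c ** (x :: 'n::finite cmat)"
  by (simp add: vec_eq_iff)
     (simp add: matrix_matrix_mult_def mat_def if_distrib[of "\<lambda>x. _ * x"] mult.commute cong: if_cong)

lemma mult_mat_left_commute: "(x :: 'n::finite cmat) ** (mat c ** y) = mat c ** (x ** (y :: 'n cmat))"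
  unfolding matrix_mul_assoc mat_central[of x c] ..

lemma mat_mult_vec: "mat c *v v = c *s (v :: complex^'n::finite)"
  by (simp add: vec_eq_iff matrix_vector_mult_def mat_def if_distrib[of "\<lambda>x. x * _"] cong: if_cong)

lemma mat_of_real_mult: "mat (of_real r) ** x = r *\<^sub>R (x :: 'n::finite cmat)"
  by (simp add: vec_eq_iff complex_eq_iff)

lemma matrix_add_rdistrib: "(y + z) ** x = y ** x + z ** (x :: 'n::finite cmat)"
  by (simp add: vec_eq_iff matrix_matrix_mult_def algebra_simps sum.distrib)

lemma matrix_mult_0 [simp]: "x ** 0 = (0 :: 'n::finite cmat)" "0 ** x = (0 :: 'n::finite cmat)"
  by (simp_all add: vec_eq_iff matrix_matrix_mult_def)

lemma matrix_mult_sum_left: "(\<Sum>i\<in>I. g i) ** y = (\<Sum>i\<in>I. g i ** (y :: 'n::finite cmat))"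
  by (induct I rule: infinite_finite_induct) (auto simp: matrix_add_rdistrib)

lemma matrix_mult_sum_right: "y ** (\<Sum>i\<in>I. g i) = (\<Sum>i\<in>I. (y :: 'n::finite cmat) ** g i)"
  by (induct I rule: infinite_finite_induct) (auto simp: matrix_add_ldistrib)

lemma matrix_vector_sum_left: "(\<Sum>i\<in>I. g i) *v v = (\<Sum>i\<in>I. (g i :: 'n::finite cmat) *v v)"
  by (induct I rule: infinite_finite_induct) (auto simp: matrix_vector_mult_add_rdistrib)

lemma matrix_diff_ldistrib: "x ** (y - z) = x ** y - x ** (z :: 'n::finite cmat)"
  by (simp add: vec_eq_iff matrix_matrix_mult_def algebra_simps sum_subtractf)

lemma matrix_diff_rdistrib: "(y - z) ** x = y ** x - z ** (x :: 'n::finite cmat)"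
  by (simp add: vec_eq_iff matrix_matrix_mult_def algebra_simps sum_subtractf)

lemma matrix_inv_unique:
  fixes A B :: "'n::finite cmat"
  assumes "A ** B = mat 1" "B ** A = mat 1"
  shows "matrix_inv A = B"
proof -
  have "A ** matrix_inv A = mat 1"
    unfolding matrix_inv_def using assms by (metis (mono_tags, lifting) someI_ex)
  then have "B ** (A ** matrix_inv A) = B"
    by simp
  then show ?thesis
    by (simp add: matrix_mul_assoc assms)
qed

lemma mat_star_star [simp]: "mat_star (mat_star x) = x"
  by (simp add: mat_star_def vec_eq_iff)

lemma mat_star_add [simp]: "mat_star (x + y) = mat_star x + mat_star y"
  by (simp add: mat_star_def vec_eq_iff)

lemma mat_star_diff [simp]: "mat_star (x - y) = mat_star x - mat_star y"
  by (simp add: mat_star_def vec_eq_iff)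

lemma mat_star_0 [simp]: "mat_star 0 = 0"
  by (simp add: mat_star_def vec_eq_iff)

lemma mat_star_eq_0_iff [simp]: "mat_star x = 0 \<longleftrightarrow> x = 0"
  using mat_star_star mat_star_0 by metis

lemma mat_star_mult [simp]: "mat_star (x ** y) = mat_star y ** mat_star x"
  by (simp add: mat_star_def vec_eq_iff matrix_matrix_mult_def mult.commute)

lemma mat_star_mat [simp]: "mat_star (mat c) = mat (cnj c)"
  by (simp add: mat_star_def vec_eq_iff mat_def)

lemma mat_star_sum: "mat_star (\<Sum>i\<in>I. g i) = (\<Sum>i\<in>I. mat_star (g i))"
  by (induct I rule: infinite_finite_induct) auto

lemma mat_star_scale: "mat_star (mat c ** x) = mat (cnj c) ** mat_star x"
  by (simp add: mat_central)

lemma trace_zero [simp]: "trace (0 :: 'n::finite cmat) = 0"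
  by (simp add: trace_def)

lemma trace_sum: "trace (\<Sum>i\<in>I. g i) = (\<Sum>i\<in>I. trace (g i :: 'n::finite cmat))"
  by (induct I rule: infinite_finite_induct) (auto simp: trace_def sum.distrib)

lemma trace_scale: "trace (mat c ** x) = c * trace (x :: 'n::finite cmat)"
  by (simp add: trace_def sum_distrib_left)

section \<open>The complex inner product, rank-one operators and the Hilbert-Schmidt norm\<close>

lemma cinner_add_left: "cinner (u + v) w = cinner u w + cinner v w"
  and cinner_add_right: "cinner w (u + v) = cinner w u + cinner w v"
  and cinner_diff_right: "cinner w (u - v) = cinner w u - cinner w v"
  and cinner_scale_left: "cinner (c *s u) w = cnj c * cinner u w"
  and cinner_scale_right: "cinner w (c *s u) = c * cinner w u"
  by (simp_all add: cinner_def algebra_simps sum.distrib sum_subtractf sum_distrib_left)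

lemma cinner_0_left [simp]: "cinner 0 w = 0" and cinner_0_right [simp]: "cinner w 0 = 0"
  by (simp_all add: cinner_def)

lemma cinner_sum_right: "cinner w (\<Sum>i\<in>I. g i) = (\<Sum>i\<in>I. cinner w (g i))"
  by (induct I rule: infinite_finite_induct) (auto simp: cinner_add_right)

lemma cinner_commute: "cinner v u = cnj (cinner u v)"
  by (simp add: cinner_def mult.commute)

lemma Re_cinner: "Re (cinner u v) = inner u v"
  by (simp add: cinner_def inner_vec_def inner_complex_def)

lemma cinner_self: "cinner u u = of_real ((norm u)\<^sup>2)"
proof (rule complex_eqI)
  show "Re (cinner u u) = Re (complex_of_real ((norm u)\<^sup>2))"
    by (simp add: Re_cinner power2_norm_eq_inner)
  have "cnj (cinner u u) = cinner u u"
    by (simp flip: cinner_commute)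
  then show "Im (cinner u u) = Im (complex_of_real ((norm u)\<^sup>2))"
    by (simp add: complex_eq_iff)
qed

lemma cinner_self_eq_0 [simp]: "cinner u u = 0 \<longleftrightarrow> u = 0"
  by (simp add: cinner_self)

lemma cinner_star: "cinner u (x *v v) = cinner (mat_star x *v u) v"
proof -
  have "cinner u (x *v v) = (\<Sum>i\<in>UNIV. \<Sum>j\<in>UNIV. cnj (u $ i) * (x $ i $ j * v $ j))"
    by (simp add: cinner_def matrix_vector_mult_def sum_distrib_left)
  also have "\<dots> = (\<Sum>j\<in>UNIV. \<Sum>i\<in>UNIV. cnj (u $ i) * (x $ i $ j * v $ j))"
    by (rule sum.swap)
  also have "\<dots> = cinner (mat_star x *v u) v"
    by (simp add: cinner_def matrix_vector_mult_def mat_star_def sum_distrib_right sum_distrib_left mult_ac)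
  finally show ?thesis .
qed

lemma cinner_axis: "cinner (axis i 1) (x *v axis j 1) = x $ i $ j"
  by (simp add: cinner_def matrix_vector_mult_def axis_def if_distrib[of "\<lambda>y. _ * y"]
      if_distrib[of "\<lambda>y. y * _"] if_distrib[of cnj] cong: if_cong)

text \<open>The operator \<open>|u><v|\<close>. Averages of such operators supply the elements of
  the commutant that occur in Connes' operator.\<close>

definition outer :: "complex^'n \<Rightarrow> complex^'n \<Rightarrow> 'n::finite cmat" where
  "outer u v = (\<chi> i j. u $ i * cnj (v $ j))"

lemma outer_mult_vec: "outer u v *v w = cinner v w *s u"
  by (simp add: outer_def vec_eq_iff matrix_vector_mult_def cinner_def sum_distrib_left sum_distrib_right mult_ac)

lemma trace_mult_outer: "trace (x ** outer u v) = cinner v (x *v u)"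
  by (simp add: trace_def outer_def matrix_matrix_mult_def cinner_def matrix_vector_mult_def
      sum_distrib_left mult_ac)

lemma mat_star_outer: "mat_star (outer u v) = outer v u"
  by (simp add: mat_star_def outer_def mult.commute)

lemma trace_star_mult_self:
  "trace (mat_star x ** x) = (\<Sum>j\<in>UNIV. of_real ((norm (x *v axis j 1))\<^sup>2))"
proof -
  have "(x *v axis j 1) $ i = x $ i $ j" for i j
    by (simp add: matrix_vector_mult_def axis_def if_distrib[of "\<lambda>y. _ * y"] cong: if_cong)
  then show ?thesis
    unfolding cinner_self[symmetric]
    by (simp add: trace_def matrix_matrix_mult_def mat_star_def cinner_def)
qed

lemma trace_star_mult_self_nonneg: "trace (mat_star x ** x) \<in> \<real>\<^sub>\<ge>\<^sub>0"
  unfolding trace_star_mult_self of_real_sum[symmetric] nonneg_Reals_of_real_iff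
  by (simp add: sum_nonneg)

lemma trace_star_mult_self_eq_0: "trace (mat_star x ** x) = 0 \<longleftrightarrow> x = 0"
proof
  assume "trace (mat_star x ** x) = 0"
  then have "(\<Sum>i\<in>UNIV. \<Sum>j\<in>UNIV. (cmod (x $ j $ i))\<^sup>2) = 0"
    by (simp add: trace_def matrix_matrix_mult_def mat_star_def complex_norm_square[symmetric]
        mult.commute[of "cnj _"] flip: of_real_sum of_real_power)
  then show "x = 0"
    by (simp add: sum_nonneg_eq_0_iff sum_nonneg vec_eq_iff)
qed (simp add: trace_def)

text \<open>Polarisation: \<open>\<xi> + \<eta>\<close> and \<open>\<xi> + \<i> \<eta>\<close> separate \<open>\<langle>\<xi>, x \<eta>\<rangle>\<close> from \<open>\<langle>\<eta>, x \<xi>\<rangle>\<close>.\<close>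

lemma quadratic_form_eq_0:
  assumes "\<And>\<xi>. cinner \<xi> (x *v \<xi>) = 0"
  shows "x = 0"
proof -
  have "x *v v = 0" for v
  proof -
    define u where "u = x *v v"
    have "cinner u (x *v v) + cinner v (x *v u) = 0"
      using assms[of "u + v"] assms[of u] assms[of v]
      by (simp add: matrix_vector_right_distrib cinner_add_left cinner_add_right add.commute)
    moreover have "\<i> * cinner u (x *v v) - \<i> * cinner v (x *v u) = 0"
      using assms[of "u + \<i> *s v"] assms[of u] assms[of v]
      by (simp add: matrix_vector_right_distrib cinner_add_left cinner_add_right
          cinner_scale_left cinner_scale_right vec.scale)
    ultimately have "cinner u (x *v v) = 0"
      by (simp add: algebra_simps)
    then show ?thesis
      by (simp add: u_def)
  qed
  then show ?thesis
    by (simp add: matrix_eq)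
qed

lemma quadratic_form_inject:
  assumes "\<And>\<xi>. cinner \<xi> (x *v \<xi>) = cinner \<xi> (y *v \<xi>)"
  shows "x = y"
  using quadratic_form_eq_0[of "x - y"] assms
  by (simp add: matrix_vector_mult_diff_rdistrib cinner_diff_right)

section \<open>Positive semidefinite matrices and the operator norm\<close>

lemma psd_hermitian:
  assumes "psd x" shows "mat_star x = x"
proof (rule quadratic_form_inject)
  fix \<xi>
  have "cinner \<xi> (x *v \<xi>) \<in> \<real>"
    using assms by (auto simp: psd_def nonneg_Reals_subset_Reals[THEN subsetD])
  then have "cnj (cinner \<xi> (x *v \<xi>)) = cinner \<xi> (x *v \<xi>)"
    by (simp add: Reals_cnj_iff)
  then show "cinner \<xi> (mat_star x *v \<xi>) = cinner \<xi> (x *v \<xi>)"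
    by (metis cinner_commute cinner_star mat_star_star)
qed

lemma hermitian_form_real:
  assumes "mat_star x = x" shows "cinner \<xi> (x *v \<xi>) = of_real (Re (cinner \<xi> (x *v \<xi>)))"
proof -
  have "cnj (cinner \<xi> (x *v \<xi>)) = cinner (x *v \<xi>) \<xi>"
    by (rule cinner_commute[symmetric])
  also have "\<dots> = cinner \<xi> (x *v \<xi>)"
    unfolding cinner_star[of \<xi> x] assms ..
  finally show ?thesis
    by (simp add: complex_eq_iff)
qed

lemma psd_iff: "psd x \<longleftrightarrow> mat_star x = x \<and> (\<forall>\<xi>. Re (cinner \<xi> (x *v \<xi>)) \<ge> 0)"
proof
  assume "psd x"
  then show "mat_star x = x \<and> (\<forall>\<xi>. Re (cinner \<xi> (x *v \<xi>)) \<ge> 0)"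
    using psd_hermitian by (auto simp: psd_def complex_nonneg_Reals_iff)
next
  assume h: "mat_star x = x \<and> (\<forall>\<xi>. Re (cinner \<xi> (x *v \<xi>)) \<ge> 0)"
  then show "psd x"
    unfolding psd_def by (metis hermitian_form_real nonneg_Reals_of_real_iff)
qed

lemma psd_add: "psd x \<Longrightarrow> psd y \<Longrightarrow> psd (x + y)"
  by (simp add: psd_def matrix_vector_mult_add_rdistrib cinner_add_right)

lemma psd_0 [simp]: "psd 0"
  by (simp add: psd_def)

lemma psd_sum: "(\<And>i. i \<in> I \<Longrightarrow> psd (g i)) \<Longrightarrow> psd (\<Sum>i\<in>I. g i)"
  by (induct I rule: infinite_finite_induct) (auto intro: psd_add)

lemma psd_scale: "r \<ge> 0 \<Longrightarrow> psd x \<Longrightarrow> psd (mat (of_real r) ** x)"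
  by (simp add: psd_def matrix_vector_mul_assoc[symmetric] mat_mult_vec cinner_scale_right)

lemma psd_conj: "psd x \<Longrightarrow> psd (y ** x ** mat_star y)"
  unfolding psd_def matrix_vector_mul_assoc[symmetric] cinner_star[of _ y] by simp

lemma psd_mult_star: "psd (y ** mat_star y)"
  using psd_conj[of "mat 1" y] by (simp add: psd_def cinner_self)

lemma trace_psd_nonneg:
  assumes "psd x" shows "trace x \<in> \<real>\<^sub>\<ge>\<^sub>0"
proof -
  have "x $ i $ i \<in> \<real>\<^sub>\<ge>\<^sub>0" for i
    using assms unfolding psd_def by (metis cinner_axis)
  then show ?thesis
    by (simp add: trace_def complex_nonneg_Reals_iff sum_nonneg)
qed

text \<open>The variation of \<open>\<langle>\<xi>, x \<xi>\<rangle>\<close> at the zero \<open>v\<close> in the direction \<open>x v\<close> is \<open>2 \<parallel>x v\<parallel>\<^sup>2\<close>.\<close>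

lemma psd_null_vector:
  assumes "psd x" and v: "Re (cinner v (x *v v)) = 0"
  shows "x *v v = 0"
proof (rule ccontr)
  assume nz: "x *v v \<noteq> 0"
  define u where "u = x *v v"
  define c where "c = Re (cinner u (x *v u))"
  have c: "c \<ge> 0"
    using assms(1) by (simp add: psd_iff c_def)
  have herm: "mat_star x = x"
    using assms(1) by (rule psd_hermitian)
  have uv: "Re (cinner v (x *v u)) = (norm u)\<^sup>2" "Re (cinner u (x *v v)) = (norm u)\<^sup>2"
    using cinner_star[of v x u] by (auto simp: herm u_def cinner_self)
  have n: "(norm u)\<^sup>2 > 0"
    using nz by (simp add: u_def)
  \<comment> \<open>Any negative \<open>t\<close> close enough to 0 makes the form negative; the
    \<open>+ 1\<close> keeps the denominator positive when \<open>c = 0\<close>.\<close>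
  define t where "t = - (norm u)\<^sup>2 / (c + 1)"
  have "0 \<le> Re (cinner (v + of_real t *s u) (x *v (v + of_real t *s u)))"
    using assms(1) by (simp add: psd_iff)
  also have "\<dots> = 2 * t * (norm u)\<^sup>2 + t\<^sup>2 * c"
    using v uv by (simp add: matrix_vector_right_distrib cinner_add_left cinner_add_right vec.scale
        cinner_scale_left cinner_scale_right c_def power2_eq_square algebra_simps)
  also have "\<dots> = t * (2 * (norm u)\<^sup>2 - (norm u)\<^sup>2 * c / (c + 1))"
    by (simp add: t_def power2_eq_square algebra_simps)
  also have "\<dots> < 0"
  proof (rule mult_neg_pos)
    show "t < 0"
      using n c by (auto simp: t_def field_simps)
    have "(norm u)\<^sup>2 * c / (c + 1) \<le> (norm u)\<^sup>2"
      using c by (simp add: field_simps)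
    then show "2 * (norm u)\<^sup>2 - (norm u)\<^sup>2 * c / (c + 1) > 0"
      using n by linarith
  qed
  finally show False
    by simp
qed

text \<open>Nonnegative diagonal entries with sum zero all vanish, so every basis vector is a zero
  of the quadratic form, and \<open>psd_null_vector\<close> kills every column.\<close>

lemma trace_psd_eq_0:
  assumes "psd x" "trace x = 0" shows "x = 0"
proof -
  have "(\<Sum>i\<in>UNIV. Re (x $ i $ i)) = 0"
    using assms(2) by (simp add: trace_def complex_eq_iff)
  moreover have "Re (x $ i $ i) \<ge> 0" for i
    using assms(1) unfolding psd_iff cinner_axis[symmetric] by blast
  ultimately have "Re (x $ i $ i) = 0" for i
    by (simp add: sum_nonneg_eq_0_iff)
  then have "x *v axis i 1 = 0" for i
    using psd_null_vector[OF assms(1), of "axis i 1"] by (simp add: cinner_axis)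
  moreover have "(x *v axis j 1) $ i = x $ i $ j" for i j
    by (simp add: matrix_vector_mult_def axis_def if_distrib[of "\<lambda>y. _ * y"] cong: if_cong)
  ultimately have "x $ i $ j = 0" for i j
    by (metis zero_index)
  then show ?thesis
    by (simp add: vec_eq_iff)
qed

text \<open>\<open>v\<close> minimises the quadratic form on the compact unit sphere. Then
  \<open>x - l\<close> is positive semidefinite and its form vanishes at \<open>v\<close>, so
  \<open>psd_null_vector\<close> turns the minimiser into an eigenvector.\<close>

lemma hermitian_min_eigenvalue:
  fixes x :: "'n::finite cmat"
  assumes herm: "mat_star x = x"
  obtains l :: real and v where "v \<noteq> 0" "x *v v = of_real l *s v"
    "\<And>w. Re (cinner w (x *v w)) \<ge> l * (norm w)\<^sup>2"
proof -
  define S where "S = sphere (0 :: complex^'n) 1"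
  have cont: "continuous_on S (\<lambda>v. inner v (x *v v))"
    by (intro continuous_intros linear_continuous_on matrix_vector_mul_bounded_linear)
  have "compact S" "S \<noteq> {}"
    by (auto simp: S_def)
  from continuous_attains_inf[OF this cont]
  obtain v where v: "v \<in> S" "\<And>w. w \<in> S \<Longrightarrow> inner v (x *v v) \<le> inner w (x *v w)"
    by auto
  define l where "l = inner v (x *v v)"
  have nv: "norm v = 1"
    using v(1) unfolding S_def by simp
  have min: "Re (cinner w (x *v w)) \<ge> l * (norm w)\<^sup>2" for w
  proof (cases "w = 0")
    case False
    define w' where "w' = w /\<^sub>R norm w"
    have w: "w = norm w *\<^sub>R w'"
      using False by (simp add: w'_def)
    have "w' \<in> S"
      using False by (simp add: S_def w'_def)
    then have "l \<le> inner w' (x *v w')"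
      using v(2) by (simp add: l_def)
    then have "l * (norm w)\<^sup>2 \<le> inner w' (x *v w') * (norm w)\<^sup>2"
      by (intro mult_right_mono) auto
    also have "\<dots> = inner (norm w *\<^sub>R w') (x *v (norm w *\<^sub>R w'))"
      by (simp add: linear_scale[OF matrix_vector_mul_linear] power2_eq_square)
    also have "\<dots> = inner w (x *v w)"
      unfolding w[symmetric] ..
    finally show ?thesis
      by (simp add: Re_cinner)
  qed simp
  have form: "cinner w ((x - mat (of_real l)) *v w) = cinner w (x *v w) - of_real (l * (norm w)\<^sup>2)" for w
    by (simp add: matrix_vector_mult_diff_rdistrib mat_mult_vec cinner_diff_right
        cinner_scale_right cinner_self del: of_real_power)
  have "psd (x - mat (of_real l))"
    unfolding psd_iff form using herm min by simp
  moreover have "Re (cinner v ((x - mat (of_real l)) *v v)) = 0"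
    unfolding form by (simp add: nv l_def Re_cinner)
  ultimately have "(x - mat (of_real l)) *v v = 0"
    by (rule psd_null_vector)
  then have "x *v v = of_real l *s v"
    by (simp add: matrix_vector_mult_diff_rdistrib mat_mult_vec)
  moreover have "v \<noteq> 0"
    using nv by auto
  ultimately show ?thesis
    using that min by blast
qed

lemma op_norm_mat: "op_norm (mat c :: 'n::finite cmat) = cmod c"
proof -
  have "norm (c *s v) = cmod c * norm v" for v :: "complex^'n"
    by (simp add: norm_vec_def norm_mult L2_set_def power_mult_distrib real_sqrt_mult
        flip: sum_distrib_left)
  moreover have "norm (axis undefined 1 :: complex^'n) = 1"
    by (simp add: norm_axis_1)
  moreover have "norm (mat c *v axis undefined 1 :: complex^'n) \<le>
      onorm ((*v) (mat c :: 'n cmat)) * norm (axis undefined 1 :: complex^'n)"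
    by (intro onorm matrix_vector_mul_bounded_linear)
  ultimately show ?thesis
    unfolding op_norm_def by (intro antisym onorm_bound) (simp_all add: mat_mult_vec)
qed

lemma psd_op_norm_diff:
  assumes "psd (x :: 'n::finite cmat)"
  shows "psd (mat (of_real (op_norm x)) - x)"
  unfolding psd_iff
proof (intro conjI allI)
  show "mat_star (mat (complex_of_real (op_norm x)) - x) = mat (complex_of_real (op_norm x)) - x"
    using psd_hermitian[OF assms] by simp
  fix \<xi> :: "complex^'n"
  have "inner \<xi> (x *v \<xi>) \<le> norm \<xi> * norm (x *v \<xi>)"
    by (rule norm_cauchy_schwarz)
  also have "\<dots> \<le> norm \<xi> * (op_norm x * norm \<xi>)"
    unfolding op_norm_def by (intro mult_left_mono onorm matrix_vector_mul_bounded_linear norm_ge_zero)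
  finally have "inner \<xi> (x *v \<xi>) \<le> op_norm x * (norm \<xi>)\<^sup>2"
    by (simp add: power2_eq_square mult_ac)
  then show "Re (cinner \<xi> ((mat (complex_of_real (op_norm x)) - x) *v \<xi>)) \<ge> 0"
    by (simp add: matrix_vector_mult_diff_rdistrib mat_mult_vec cinner_diff_right
        cinner_scale_right cinner_self Re_cinner)
qed

section \<open>Unital star-subalgebras and their commutants\<close>

definition star_subalgebra :: "'n::finite cmat set \<Rightarrow> bool" where
  "star_subalgebra A \<longleftrightarrow> mat 1 \<in> A \<and> (\<forall>x\<in>A. \<forall>y\<in>A. x + y \<in> A \<and> x ** y \<in> A) \<and>
     (\<forall>x\<in>A. \<forall>c. mat c ** x \<in> A) \<and> (\<forall>x\<in>A. mat_star x \<in> A)"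

lemma star_subalgebraD:
  assumes "star_subalgebra A"
  shows "mat 1 \<in> A" "x \<in> A \<Longrightarrow> y \<in> A \<Longrightarrow> x + y \<in> A" "x \<in> A \<Longrightarrow> y \<in> A \<Longrightarrow> x ** y \<in> A"
    "x \<in> A \<Longrightarrow> mat c ** x \<in> A" "x \<in> A \<Longrightarrow> mat_star x \<in> A"
  using assms by (auto simp: star_subalgebra_def)

lemma star_subalgebra_mat: "star_subalgebra A \<Longrightarrow> mat c \<in> A"
  using star_subalgebraD(1) star_subalgebraD(4)[of A "mat 1" c] by fastforce

lemma star_subalgebra_0: "star_subalgebra A \<Longrightarrow> 0 \<in> A"
  using star_subalgebra_mat[of A 0] by simp

lemma star_subalgebra_diff:
  assumes "star_subalgebra A" "x \<in> A" "y \<in> A" shows "x - y \<in> A"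
proof -
  have "mat (-1) ** y = - y"
    by (simp add: vec_eq_iff)
  then show ?thesis
    using star_subalgebraD(2)[OF assms(1,2)] star_subalgebraD(4)[OF assms(1,3), of "-1"] by fastforce
qed

lemma star_subalgebra_sum:
  assumes "star_subalgebra A" "\<And>i. i \<in> I \<Longrightarrow> g i \<in> A" shows "(\<Sum>i\<in>I. g i) \<in> A"
  using assms(2) by (induct I rule: infinite_finite_induct)
    (auto intro: star_subalgebra_0[OF assms(1)] star_subalgebraD(2)[OF assms(1)])

lemma commutantD: "x \<in> commutant A \<Longrightarrow> a \<in> A \<Longrightarrow> x ** a = a ** x"
  by (simp add: commutant_def)

lemma commutant_antimono: "A \<subseteq> B \<Longrightarrow> commutant B \<subseteq> commutant A"
  by (auto simp: commutant_def)

text \<open>Commutants can thus be treated by the same lemmas as the algebras themselves, although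
  no matrix units are chosen for them.\<close>

lemma star_subalgebra_commutant:
  assumes "star_subalgebra A" shows "star_subalgebra (commutant A)"
proof -
  have "x ** y ** a = a ** (x ** y)" if "x ** a = a ** x" "y ** a = a ** y" for x y a :: "'a cmat"
    using that by (metis matrix_mul_assoc)
  moreover have "mat_star x ** a = a ** mat_star x"
    if "\<forall>a\<in>A. x ** a = a ** x" "a \<in> A" for x a
  proof -
    have "x ** mat_star a = mat_star a ** x"
      using that star_subalgebraD(5)[OF assms] by blast
    from arg_cong[OF this, of mat_star] show ?thesis
      by simp
  qed
  moreover have "mat c ** x ** a = a ** (mat c ** x)" if "x ** a = a ** x" for x a :: "'a cmat" and c
    using that by (simp add: mult_mat_left_commute flip: matrix_mul_assoc)
  ultimately show ?thesis
    by (auto simp: star_subalgebra_def commutant_def matrix_add_ldistrib matrix_add_rdistrib)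
qed

text \<open>Left multiplication by \<open>a\<close> is an injective real-linear map of the
  finite-dimensional space \<open>A\<close> into itself, hence onto. The gain is a right inverse of
  \<open>a\<close> that lies in \<open>A\<close>.\<close>

lemma left_mult_surj:
  fixes A :: "'n::finite cmat set"
  assumes A: "star_subalgebra A" and a: "a \<in> A" and inj: "\<And>y. y \<in> A \<Longrightarrow> a ** y = 0 \<Longrightarrow> y = 0"
  shows "\<exists>y\<in>A. a ** y = mat 1"
proof -
  have sub: "subspace A"
    using star_subalgebra_0[OF A] star_subalgebraD(2)[OF A] star_subalgebraD(4)[OF A]
    by (auto simp: subspace_def simp flip: mat_of_real_mult)
  have lin: "linear (\<lambda>y :: 'n cmat. a ** y)"
    by (rule linearI) (simp_all only: matrix_add_ldistrib mult_mat_left_commute mat_of_real_mult[symmetric])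
  have "inj_on (\<lambda>y. a ** y) (span A)"
    unfolding span_eq_iff[THEN iffD2, OF sub]
  proof (rule inj_onI)
    fix x y assume "x \<in> A" "y \<in> A" "a ** x = a ** y"
    then show "x = y"
      using inj[of "x - y"] star_subalgebra_diff[OF A, of x y] by (simp add: matrix_diff_ldistrib)
  qed
  then have "dim ((\<lambda>y. a ** y) ` A) = dim A"
    by (rule dim_image_eq[OF lin])
  moreover have "(\<lambda>y. a ** y) ` A \<subseteq> A"
    using star_subalgebraD(3)[OF A a] by auto
  ultimately have "(\<lambda>y. a ** y) ` A = A"
    by (intro subspace_dim_equal linear_subspace_image[OF lin] sub) auto
  then show ?thesis
    using star_subalgebraD(1)[OF A] by (metis imageE)
qed

lemma star_subalgebra_inverse:
  fixes A :: "'n::finite cmat set"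
  assumes A: "star_subalgebra A" and a: "a \<in> A" and inv: "a ** b = mat 1"
  shows "b \<in> A"
proof -
  have ba: "b ** a = mat 1"
    using inv by (simp add: matrix_left_right_inverse)
  have left: "y = b ** (a ** y)" for y :: "'n cmat"
    by (simp add: matrix_mul_assoc ba)
  have "\<exists>y\<in>A. a ** y = mat 1"
  proof (rule left_mult_surj[OF A a])
    show "y = 0" if "a ** y = 0" for y :: "'n cmat"
      using left[of y] that by simp
  qed
  then obtain y where "y \<in> A" "a ** y = mat 1"
    by blast
  then show ?thesis
    using left[of y] by simp
qed

text \<open>Replaces a null vector in the Hilbert space by an annihilated element of the algebra, on
  which functionals can be evaluated. Were left multiplication by \<open>a\<close> injective on
  \<open>A\<close>, then \<open>a\<close> would be invertible and \<open>v\<close> zero.\<close>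

lemma annihilator_exists:
  assumes A: "star_subalgebra A" and a: "a \<in> A" and v: "v \<noteq> 0" "a *v v = 0"
  shows "\<exists>y\<in>A. y \<noteq> 0 \<and> a ** y = 0"
proof (rule ccontr)
  assume "\<not> ?thesis"
  then obtain y where "a ** y = mat 1"
    using left_mult_surj[OF A a] by blast
  then have "y ** a = mat 1"
    by (simp add: matrix_left_right_inverse)
  then have "v = y *v (a *v v)"
    by (simp add: matrix_vector_mul_assoc)
  then show False
    using v by simp
qed

section \<open>Positive functionals\<close>

lemma pos_functionalD:
  assumes "pos_functional A \<phi>"
  shows "x \<in> A \<Longrightarrow> y \<in> A \<Longrightarrow> \<phi> (x + y) = \<phi> x + \<phi> y" "x \<in> A \<Longrightarrow> \<phi> (mat c ** x) = c * \<phi> x"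
    "x \<in> A \<Longrightarrow> \<phi> (mat_star x ** x) \<in> \<real>\<^sub>\<ge>\<^sub>0"
  using assms by (auto simp: pos_functional_def)

lemma pos_functional_sum:
  assumes "pos_functional A \<phi>" "star_subalgebra A" "\<And>i. i \<in> I \<Longrightarrow> g i \<in> A"
  shows "\<phi> (\<Sum>i\<in>I. g i) = (\<Sum>i\<in>I. \<phi> (g i))"
proof -
  have "\<phi> 0 = 0"
    using pos_functionalD(2)[OF assms(1) star_subalgebra_0[OF assms(2)], of 0] by simp
  then show ?thesis
    using assms(3)
    by (induct I rule: infinite_finite_induct)
       (auto simp: pos_functionalD(1)[OF assms(1)] star_subalgebra_sum[OF assms(2)])
qed

lemma pos_functional_diff:
  assumes "pos_functional A \<phi>" "star_subalgebra A" "x \<in> A" "y \<in> A"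
  shows "\<phi> (x - y) = \<phi> x - \<phi> y"
  using pos_functionalD(1)[OF assms(1), of "x - y" y] star_subalgebra_diff[OF assms(2-4)] assms(4)
  by (simp add: algebra_simps)

text \<open>Positivity at \<open>x + mat c\<close> forces the cross terms
  \<open>c * \<phi> (mat_star x) + cnj c * \<phi> x\<close> to be real for every \<open>c\<close>.
  The choices \<open>c = 1\<close> and \<open>c = \<i>\<close> compare the imaginary and the real
  parts of the two values.\<close>

lemma pos_functional_star:
  assumes \<phi>: "pos_functional A \<phi>" and A: "star_subalgebra A" and x: "x \<in> A"
  shows "\<phi> (mat_star x) = cnj (\<phi> x)"
proof -
  note in_A = star_subalgebraD[OF A] star_subalgebra_mat[OF A]
  have real: "Im (\<phi> (mat_star y ** y)) = 0" if "y \<in> A" for y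
    using pos_functionalD(3)[OF \<phi> that] by (simp add: complex_nonneg_Reals_iff)
  have \<phi>_mat: "\<phi> (mat c) = c * \<phi> (mat 1)" for c
    using pos_functionalD(2)[OF \<phi>, of "mat 1" c] in_A by simp
  have expand: "Im (c * \<phi> (mat_star x) + cnj c * \<phi> x) = 0" for c
  proof -
    have "mat_star (x + mat c) ** (x + mat c) =
        mat_star x ** x + (mat c ** mat_star x + (mat (cnj c) ** x + mat (cnj c * c)))"
      by (simp add: matrix_add_ldistrib matrix_add_rdistrib mat_central[of "mat_star x"] mat_mult)
    then have "\<phi> (mat_star (x + mat c) ** (x + mat c)) =
        \<phi> (mat_star x ** x) + ((c * \<phi> (mat_star x) + cnj c * \<phi> x) + cnj c * c * \<phi> (mat 1))"
      using x in_A pos_functionalD(1,2)[OF \<phi>] \<phi>_mat[of "cnj c * c"] by (simp add: add.assoc)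
    moreover have "Im (cnj c * c * \<phi> (mat 1)) = 0"
      using real[of "mat 1"] in_A by simp
    moreover have "x + mat c \<in> A"
      by (intro in_A x)
    note real[OF this]
    ultimately show ?thesis
      using real[OF x] by (simp only: plus_complex.sel add_0_left add_0_right)
  qed
  show ?thesis
    using expand[of 1] expand[of \<i>] by (simp add: complex_eq_iff)
qed

lemma faithful_functional_pos: "faithful_functional A \<phi> \<Longrightarrow> pos_functional A \<phi>"
  by (simp add: faithful_functional_def)

lemma faithful_functional_nondegenerate:
  assumes "faithful_functional A \<phi>" "star_subalgebra A" "x \<in> A" "\<And>y. y \<in> A \<Longrightarrow> \<phi> (y ** x) = 0"
  shows "x = 0"
  using assms star_subalgebraD(5)[OF assms(2,3)] by (simp add: faithful_functional_def)

lemma faithful_functional_trace: "faithful_functional A trace"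
  by (simp add: faithful_functional_def pos_functional_def trace_add trace_scale
      trace_star_mult_self_nonneg trace_star_mult_self_eq_0)

text \<open>
  If \<open>h v = l v\<close> for the least eigenvalue \<open>l\<close>, then \<open>h y = l y\<close> for some nonzero \<open>y\<close> in the
  algebra, so that \<open>l T(y y\<^sup>*) = \<phi>(y y\<^sup>*)\<close> determines the sign of \<open>l\<close>.
\<close>

lemma density_lower_bound:
  assumes A: "star_subalgebra A" and T: "faithful_functional A T"
    and tracial: "\<And>x y. x \<in> A \<Longrightarrow> y \<in> A \<Longrightarrow> T (x ** y) = T (y ** x)"
    and h: "h \<in> A" and \<phi>: "pos_functional A \<phi>" and density: "\<And>x. x \<in> A \<Longrightarrow> \<phi> x = T (h ** x)"
  obtains l where "mat_star h = h" "l \<ge> 0" "faithful_functional A \<phi> \<Longrightarrow> l > 0"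
    "\<And>w. Re (cinner w (h *v w)) \<ge> l * (norm w)\<^sup>2"
proof -
  note in_A = star_subalgebraD[OF A] star_subalgebra_mat[OF A] star_subalgebra_diff[OF A] h
  note posT = faithful_functional_pos[OF T]
  \<comment> \<open>\<open>\<phi> y\<close> is computed twice, once by traciality and once through
    the hermiticity of \<open>\<phi>\<close> and \<open>T\<close>.\<close>
  have "T (y ** (h - mat_star h)) = 0" if y: "y \<in> A" for y
  proof -
    have "T (y ** h) = \<phi> y"
      using tracial[OF y h] density y by simp
    also have "\<dots> = cnj (\<phi> (mat_star y))"
      using pos_functional_star[OF \<phi> A y] by simp
    also have "\<dots> = cnj (T (h ** mat_star y))"
      using density y in_A by simp
    also have "\<dots> = T (y ** mat_star h)"
      using pos_functional_star[OF posT A, of "h ** mat_star y"] y in_A by simp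
    finally show ?thesis
      using pos_functional_diff[OF posT A, of "y ** h" "y ** mat_star h"] y in_A
      by (simp add: matrix_diff_ldistrib)
  qed
  then have "h - mat_star h = 0"
    by (intro faithful_functional_nondegenerate[OF T A]) (auto intro: in_A)
  then have herm: "mat_star h = h"
    by simp
  then obtain l v where v: "v \<noteq> 0" "h *v v = of_real l *s v"
    and min: "\<And>w. Re (cinner w (h *v w)) \<ge> l * (norm w)\<^sup>2"
    using hermitian_min_eigenvalue by blast
  have "(h - mat (of_real l)) *v v = 0"
    using v by (simp add: matrix_vector_mult_diff_rdistrib mat_mult_vec)
  then obtain y where y: "y \<in> A" "y \<noteq> 0" "(h - mat (of_real l)) ** y = 0"
    using annihilator_exists[OF A _ v(1), of "h - mat (of_real l)"] in_A(7)[OF h in_A(6)] by blast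
  have hy: "h ** y = mat (of_real l) ** y"
    using y(3) by (simp add: matrix_diff_rdistrib)
  have yy: "mat_star (mat_star y) ** mat_star y = y ** mat_star y"
    by simp
  have "\<phi> (y ** mat_star y) = of_real l * T (y ** mat_star y)"
    using density[of "y ** mat_star y"] y in_A pos_functionalD(2)[OF posT, of "y ** mat_star y"]
    by (simp add: matrix_mul_assoc hy)
  then have "Re (\<phi> (y ** mat_star y)) = l * Re (T (y ** mat_star y))"
    by simp
  moreover have "T (y ** mat_star y) \<in> \<real>\<^sub>\<ge>\<^sub>0" "\<phi> (y ** mat_star y) \<in> \<real>\<^sub>\<ge>\<^sub>0"
    using pos_functionalD(3)[OF posT, of "mat_star y"] pos_functionalD(3)[OF \<phi>, of "mat_star y"] y in_A
    by auto
  moreover have "T (y ** mat_star y) \<noteq> 0"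
    using T y in_A(5)[OF y(1)] unfolding faithful_functional_def by (metis yy mat_star_eq_0_iff)
  moreover have "\<phi> (y ** mat_star y) \<noteq> 0" if "faithful_functional A \<phi>"
    using that y in_A(5)[OF y(1)] unfolding faithful_functional_def by (metis yy mat_star_eq_0_iff)
  ultimately have "l \<ge> 0" "faithful_functional A \<phi> \<Longrightarrow> l > 0"
    by (auto simp: complex_nonneg_Reals_iff complex_eq_iff zero_le_mult_iff zero_less_mult_iff)
  then show ?thesis
    using that herm min by blast
qed

lemma density_psd:
  assumes "star_subalgebra A" "faithful_functional A T"
    and "\<And>x y. x \<in> A \<Longrightarrow> y \<in> A \<Longrightarrow> T (x ** y) = T (y ** x)"
    and "h \<in> A" "pos_functional A \<phi>" "\<And>x. x \<in> A \<Longrightarrow> \<phi> x = T (h ** x)"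
  shows "psd h"
proof -
  obtain l where l: "mat_star h = h" "l \<ge> 0" "\<And>w. Re (cinner w (h *v w)) \<ge> l * (norm w)\<^sup>2"
    using density_lower_bound[OF assms] by blast
  then have "Re (cinner w (h *v w)) \<ge> 0" for w
    by (meson order_trans mult_nonneg_nonneg zero_le_power2)
  then show ?thesis
    using l(1) by (simp add: psd_iff)
qed

text \<open>The strictly positive lower bound of a faithful density excludes a kernel, and the
  inverse matrix stays in \<open>A\<close> by \<open>star_subalgebra_inverse\<close>.\<close>

lemma density_invertible:
  assumes "star_subalgebra A" "faithful_functional A T"
    and "\<And>x y. x \<in> A \<Longrightarrow> y \<in> A \<Longrightarrow> T (x ** y) = T (y ** x)"
    and "h \<in> A" "faithful_functional A \<phi>" "\<And>x. x \<in> A \<Longrightarrow> \<phi> x = T (h ** x)"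
  obtains g where "g \<in> A" "h ** g = mat 1" "g ** h = mat 1"
proof -
  obtain l where l: "l > 0" "\<And>w. Re (cinner w (h *v w)) \<ge> l * (norm w)\<^sup>2"
    using density_lower_bound[OF assms(1-4) faithful_functional_pos[OF assms(5)] assms(6)] assms(5)
    by metis
  have "w = 0" if "h *v w = 0" for w
    using l(2)[of w] l(1) that by (simp add: mult_le_0_iff)
  then obtain g where g: "g ** h = mat 1"
    using matrix_left_invertible_ker[of h] by blast
  then have "h ** g = mat 1"
    by (simp add: matrix_left_right_inverse)
  then show ?thesis
    using that g star_subalgebra_inverse[OF assms(1,4)] by blast
qed

section \<open>Multi-matrix algebras with their regular trace\<close>

text \<open>
  In terms of matrix units \<open>e\<^sup>i\<^sub>a\<^sub>b\<close> of a multi-matrix algebra with summands of size \<open>d\<^sub>i\<close>, the family \<open>f\<close>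
  consists of the \<open>d\<^sub>i\<^sup>-\<^sup>1\<^sup>/\<^sup>2 e\<^sup>i\<^sub>a\<^sub>b\<close>, and \<open>T\<close> is the trace of the left regular representation,
  extended to all matrices. In particular \<open>T(1)\<close> is the dimension of the algebra.
\<close>

locale regular_trace =
  fixes A :: "'n::finite cmat set" and I :: "'i set" and f :: "'i \<Rightarrow> 'n cmat" and T :: "'n cmat \<Rightarrow> complex"
  assumes alg: "star_subalgebra A"
    and finite_index: "finite I"
    and f_in: "i \<in> I \<Longrightarrow> f i \<in> A"
    and T_add: "T (x + y) = T x + T y"
    and T_scale: "T (mat c ** x) = c * T x"
    and tracial: "x \<in> A \<Longrightarrow> y \<in> A \<Longrightarrow> T (x ** y) = T (y ** x)"
    and T_psd: "psd x \<Longrightarrow> T x \<in> \<real>\<^sub>\<ge>\<^sub>0"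
    and T_faithful: "T (mat_star x ** x) = 0 \<Longrightarrow> x = 0"
    and expansion: "x \<in> A \<Longrightarrow> (\<Sum>i\<in>I. mat (T (mat_star (f i) ** x)) ** f i) = x"
    and f_fstar: "(\<Sum>i\<in>I. f i ** mat_star (f i)) = mat 1"
    and fstar_f: "(\<Sum>i\<in>I. mat_star (f i) ** f i) = mat 1"
begin

lemmas alg_closed = star_subalgebraD[OF alg] star_subalgebra_mat[OF alg] star_subalgebra_diff[OF alg]

lemmas alg_commutant = star_subalgebra_commutant[OF alg]

lemma fstar_in: "i \<in> I \<Longrightarrow> mat_star (f i) \<in> A"
  by (simp add: alg_closed f_in)

lemma T_faithful_functional: "B \<subseteq> A \<Longrightarrow> faithful_functional B T"
  using T_add T_scale T_psd[OF psd_mult_star[of "mat_star x" for x]] T_faithful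
  by (auto simp: faithful_functional_def pos_functional_def)

lemmas T_pos_functional = faithful_functional_pos[OF T_faithful_functional]

lemma T_sum: "T (\<Sum>i\<in>J. g i) = (\<Sum>i\<in>J. T (g i))"
proof -
  have "T 0 = 0"
    using T_scale[of 0 0] by simp
  then show ?thesis
    by (induct J rule: infinite_finite_induct) (auto simp: T_add)
qed

lemma T_1_pos: "Re (T (mat 1)) > 0" "T (mat 1) = of_real (Re (T (mat 1)))"
proof -
  have "T (mat 1) \<in> \<real>\<^sub>\<ge>\<^sub>0"
    by (rule T_psd) (simp add: psd_def cinner_self)
  moreover have "(mat 1 :: 'n cmat) \<noteq> 0"
    by (metis mat_mult_vec matrix_vector_mult_0 vector_smult_lid axis_eq_0_iff zero_neq_one)
  then have "T (mat 1) \<noteq> 0"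
    using T_faithful[of "mat 1"] by auto
  ultimately show "Re (T (mat 1)) > 0" "T (mat 1) = of_real (Re (T (mat 1)))"
    by (auto simp: complex_nonneg_Reals_iff complex_eq_iff)
qed

text \<open>The adjoint of \<open>expansion\<close> at \<open>mat_star x\<close>. With both forms an
  element can be expanded at the left or at the right end of a product.\<close>

lemma expansion_star:
  assumes x: "x \<in> A"
  shows "(\<Sum>i\<in>I. mat (T (f i ** x)) ** mat_star (f i)) = x"
proof -
  have "x = mat_star (\<Sum>i\<in>I. mat (T (mat_star (f i) ** mat_star x)) ** f i)"
    using expansion[of "mat_star x"] x by (simp add: alg_closed)
  also have "\<dots> = (\<Sum>i\<in>I. mat (cnj (T (mat_star (x ** f i)))) ** mat_star (f i))"
    by (simp only: mat_star_sum mat_star_scale) simp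
  also have "\<dots> = (\<Sum>i\<in>I. mat (T (f i ** x)) ** mat_star (f i))"
  proof (rule sum.cong[OF refl])
    fix i assume "i \<in> I"
    then have "cnj (T (mat_star (x ** f i))) = T (f i ** x)"
      using pos_functional_star[OF T_pos_functional alg, of "x ** f i"] tracial[of x "f i"]
      by (simp del: mat_star_mult add: alg_closed f_in x)
    then show "mat (cnj (T (mat_star (x ** f i)))) ** mat_star (f i) = mat (T (f i ** x)) ** mat_star (f i)"
      by simp
  qed
  finally show ?thesis ..
qed

section \<open>Densities of functionals and the average onto the commutant\<close>

definition density :: "('n cmat \<Rightarrow> complex) \<Rightarrow> 'n cmat" where
  "density \<phi> = (\<Sum>i\<in>I. mat (\<phi> (f i)) ** mat_star (f i))"

lemma density_in: "density \<phi> \<in> A"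
  unfolding density_def by (intro star_subalgebra_sum[OF alg] alg_closed fstar_in)

text \<open>Riesz representation: \<open>\<phi>\<close> applied to the expansion of \<open>x\<close>
  leaves the numbers \<open>\<phi> (f i)\<close>, which reassemble to the density.\<close>

lemma density:
  assumes \<phi>: "pos_functional A \<phi>" and x: "x \<in> A"
  shows "\<phi> x = T (density \<phi> ** x)"
proof -
  have "\<phi> x = \<phi> (\<Sum>i\<in>I. mat (T (mat_star (f i) ** x)) ** f i)"
    using expansion[OF x] by simp
  also have "\<dots> = (\<Sum>i\<in>I. \<phi> (mat (T (mat_star (f i) ** x)) ** f i))"
    by (intro pos_functional_sum[OF \<phi> alg] alg_closed f_in)
  also have "\<dots> = (\<Sum>i\<in>I. \<phi> (f i) * T (mat_star (f i) ** x))"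
    by (intro sum.cong) (simp_all add: pos_functionalD(2)[OF \<phi>] f_in)
  also have "\<dots> = T (density \<phi> ** x)"
    by (simp add: density_def matrix_mult_sum_left T_sum T_scale flip: matrix_mul_assoc)
  finally show ?thesis .
qed

lemma density_T: "density T = mat 1"
  using expansion_star[of "mat 1"] by (simp add: density_def alg_closed)

text \<open>The trace-preserving conditional expectation from all matrices onto
  \<open>commutant A\<close>, with matrix units in place of an average over the unitary group. On
  \<open>A\<close> it is the center-valued trace.\<close>

definition avg :: "'n cmat \<Rightarrow> 'n cmat" where
  "avg x = (\<Sum>i\<in>I. f i ** x ** mat_star (f i))"

text \<open>By traciality, the coefficients of \<open>y ** f j\<close> in the family
  \<open>f\<close> are also the coefficients of \<open>mat_star (f i) ** y\<close> in the adjoint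
  family, so \<open>y\<close> travels from the left end of the double sum to the right end.\<close>

lemma avg_commutant: "avg x \<in> commutant A"
proof -
  have "avg x ** y = y ** avg x" if y: "y \<in> A" for y
  proof -
    have "y ** avg x = (\<Sum>j\<in>I. (y ** f j) ** x ** mat_star (f j))"
      by (simp add: avg_def matrix_mult_sum_right matrix_mul_assoc)
    also have "\<dots> = (\<Sum>j\<in>I. \<Sum>i\<in>I. mat (T (mat_star (f i) ** (y ** f j))) ** (f i ** x ** mat_star (f j)))"
    proof (rule sum.cong[OF refl])
      fix j assume "j \<in> I"
      then have "(\<Sum>i\<in>I. mat (T (mat_star (f i) ** (y ** f j))) ** f i) = y ** f j"
        by (intro expansion alg_closed f_in y)
      note arg_cong[OF this, of "\<lambda>z. z ** x ** mat_star (f j)"]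
      then show "(y ** f j) ** x ** mat_star (f j) =
          (\<Sum>i\<in>I. mat (T (mat_star (f i) ** (y ** f j))) ** (f i ** x ** mat_star (f j)))"
        by (simp add: matrix_mult_sum_left matrix_mul_assoc)
    qed
    also have "\<dots> = (\<Sum>i\<in>I. \<Sum>j\<in>I. mat (T (mat_star (f i) ** (y ** f j))) ** (f i ** x ** mat_star (f j)))"
      by (rule sum.swap)
    also have "\<dots> = (\<Sum>i\<in>I. f i ** x ** (mat_star (f i) ** y))"
    proof (rule sum.cong[OF refl])
      fix i assume i: "i \<in> I"
      have "mat_star (f i) ** y = (\<Sum>j\<in>I. mat (T (f j ** (mat_star (f i) ** y))) ** mat_star (f j))"
        using expansion_star[of "mat_star (f i) ** y"] y i by (simp add: alg_closed f_in)
      also have "\<dots> = (\<Sum>j\<in>I. mat (T (mat_star (f i) ** (y ** f j))) ** mat_star (f j))"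
        using tracial[of _ "mat_star (f i) ** y"] y i by (simp add: alg_closed f_in matrix_mul_assoc)
      finally show "(\<Sum>j\<in>I. mat (T (mat_star (f i) ** (y ** f j))) ** (f i ** x ** mat_star (f j))) =
          f i ** x ** (mat_star (f i) ** y)"
        by (simp add: matrix_mult_sum_right mult_mat_left_commute)
    qed
    also have "\<dots> = avg x ** y"
      by (simp add: avg_def matrix_mult_sum_left matrix_mul_assoc)
    finally show ?thesis ..
  qed
  then show ?thesis
    by (simp add: commutant_def)
qed

lemma avg_mult_right: "y \<in> commutant A \<Longrightarrow> avg (x ** y) = avg x ** y"
  by (simp add: avg_def matrix_mult_sum_left matrix_mul_assoc[symmetric] commutantD[OF _ fstar_in])

lemma avg_fixes: "y \<in> commutant A \<Longrightarrow> avg y = y"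
  using avg_mult_right[of y "mat 1"] f_fstar by (simp add: avg_def)

lemma avg_star: "mat_star (avg x) = avg (mat_star x)"
  by (simp add: avg_def mat_star_sum matrix_mul_assoc)

lemma avg_add: "avg (x + y) = avg x + avg y"
  by (simp add: avg_def matrix_add_ldistrib matrix_add_rdistrib sum.distrib)

lemma avg_scale: "avg (mat c ** x) = mat c ** avg x"
  by (simp add: avg_def matrix_mult_sum_right mult_mat_left_commute flip: matrix_mul_assoc)

lemma avg_sum: "avg (\<Sum>i\<in>J. g i) = (\<Sum>i\<in>J. avg (g i))"
proof -
  have "avg 0 = 0"
    by (simp add: avg_def)
  then show ?thesis
    by (induct J rule: infinite_finite_induct) (auto simp: avg_add)
qed

lemma avg_psd: "psd x \<Longrightarrow> psd (avg x)"
  unfolding avg_def by (intro psd_sum psd_conj)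

lemma avg_in: "x \<in> A \<Longrightarrow> avg x \<in> A"
  unfolding avg_def by (intro star_subalgebra_sum[OF alg] alg_closed f_in fstar_in)

lemma trace_avg_mult:
  assumes "y \<in> commutant A" shows "trace (avg x ** y) = trace (x ** y)"
proof -
  have "trace (avg x ** y) = (\<Sum>i\<in>I. trace (f i ** (x ** y ** mat_star (f i))))"
    using commutantD[OF assms fstar_in]
    by (simp add: avg_def matrix_mult_sum_left trace_sum matrix_mul_assoc[symmetric])
  also have "\<dots> = (\<Sum>i\<in>I. trace (x ** y ** (mat_star (f i) ** f i)))"
    by (subst trace_mul_sym) (simp add: matrix_mul_assoc)
  also have "\<dots> = trace (x ** y)"
    by (simp add: fstar_f flip: trace_sum matrix_mult_sum_right)
  finally show ?thesis .
qed

text \<open>Cyclicity brings \<open>mat_star (f i)\<close> next to \<open>f i\<close>. Unlike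
  \<open>trace_avg_mult\<close>, this concerns a trace given on \<open>A\<close> only; it serves
  both the regular trace and the Markov trace.\<close>

lemma T_avg:
  assumes \<tau>: "pos_functional A \<tau>" and tr: "\<And>x y. x \<in> A \<Longrightarrow> y \<in> A \<Longrightarrow> \<tau> (x ** y) = \<tau> (y ** x)"
    and x: "x \<in> A"
  shows "\<tau> (avg x) = \<tau> x"
proof -
  have "\<tau> (avg x) = (\<Sum>i\<in>I. \<tau> (f i ** x ** mat_star (f i)))"
    unfolding avg_def by (intro pos_functional_sum[OF \<tau> alg] alg_closed f_in fstar_in x)
  also have "\<dots> = (\<Sum>i\<in>I. \<tau> (x ** (mat_star (f i) ** f i)))"
  proof (rule sum.cong[OF refl])
    fix i assume i: "i \<in> I"
    have "\<tau> (f i ** (x ** mat_star (f i))) = \<tau> ((x ** mat_star (f i)) ** f i)"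
      by (intro tr alg_closed f_in i x)
    then show "\<tau> (f i ** x ** mat_star (f i)) = \<tau> (x ** (mat_star (f i) ** f i))"
      by (simp add: matrix_mul_assoc)
  qed
  also have "\<dots> = \<tau> (\<Sum>i\<in>I. x ** (mat_star (f i) ** f i))"
    by (intro pos_functional_sum[OF \<tau> alg, symmetric] alg_closed f_in fstar_in x)
  also have "\<dots> = \<tau> x"
    by (simp add: fstar_f flip: matrix_mult_sum_right)
  finally show ?thesis .
qed

text \<open>\<open>\<psi> \<circ> avg\<close> extends \<open>\<psi>\<close> to all matrices, where
  elementary matrices yield a density \<open>r\<close>. Replacing \<open>r\<close> by
  \<open>avg r\<close> moves it into the commutant without changing its trace pairing with elements
  of the commutant.\<close>

lemma commutant_density:
  assumes \<psi>: "pos_functional (commutant A) \<psi>"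
  obtains \<rho> where "\<rho> \<in> commutant A" "\<And>x. x \<in> commutant A \<Longrightarrow> \<psi> x = trace (\<rho> ** x)"
proof -
  define u where "u i j = outer (axis i 1 :: complex^'n) (axis j 1)" for i j
  define r where "r = (\<Sum>i\<in>UNIV. \<Sum>j\<in>UNIV. mat (\<psi> (avg (u i j))) ** u j i)"
  have u_component: "u i j $ a $ b = (if a = i \<and> b = j then 1 else 0)" for i j a b
    by (auto simp: u_def outer_def axis_def)
  have units: "x = (\<Sum>i\<in>UNIV. \<Sum>j\<in>UNIV. mat (x $ i $ j) ** u i j)" for x :: "'n cmat"
  proof -
    have "(\<Sum>i\<in>UNIV. \<Sum>j\<in>UNIV. x $ i $ j * (if a = i \<and> b = j then 1 else 0)) = x $ a $ b" for a b
    proof -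
      have "(\<Sum>i\<in>UNIV. \<Sum>j\<in>UNIV. x $ i $ j * (if a = i \<and> b = j then 1 else 0)) =
          (\<Sum>i\<in>UNIV. if a = i then x $ i $ b else 0)"
        by (intro sum.cong refl) (simp add: if_distrib[of "\<lambda>y. _ * y"] cong: if_cong)
      then show ?thesis
        by simp
    qed
    then show ?thesis
      by (simp add: vec_eq_iff u_component)
  qed
  have "trace (r ** x) = \<psi> x" if x: "x \<in> commutant A" for x
  proof -
    have trace_u: "trace (u j i ** x) = x $ i $ j" for i j
    proof -
      have "trace (u j i ** x) = trace (x ** u j i)"
        by (rule trace_mul_sym)
      also have "\<dots> = x $ i $ j"
        unfolding u_def trace_mult_outer by (rule cinner_axis)
      finally show ?thesis .
    qed
    have "\<psi> x = \<psi> (avg x)"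
      by (simp add: avg_fixes x)
    also have "avg x = (\<Sum>i\<in>UNIV. \<Sum>j\<in>UNIV. mat (x $ i $ j) ** avg (u i j))"
      by (subst units[of x]) (simp only: avg_sum avg_scale)
    also have "\<psi> \<dots> = (\<Sum>i\<in>UNIV. \<Sum>j\<in>UNIV. x $ i $ j * \<psi> (avg (u i j)))"
      using \<psi> alg_commutant
      by (simp add: pos_functional_sum star_subalgebra_sum star_subalgebraD avg_commutant pos_functionalD)
    also have "\<dots> = trace (r ** x)"
      by (simp add: r_def matrix_mult_sum_left trace_sum trace_scale trace_u mult.commute
          flip: matrix_mul_assoc)
    finally show ?thesis ..
  qed
  then have "trace (avg r ** x) = \<psi> x" if "x \<in> commutant A" for x
    using trace_avg_mult that by simp
  then show ?thesis
    using that[of "avg r"] avg_commutant by simp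
qed

section \<open>Spatial derivatives and Kosaki's inverse\<close>

lemma trace_nondegenerate:
  assumes "x \<in> commutant A" "\<And>y. y \<in> commutant A \<Longrightarrow> trace (x ** y) = 0"
  shows "x = 0"
  using assms(2)[of "mat_star x"] star_subalgebraD(5)[OF alg_commutant assms(1)]
    trace_star_mult_self_eq_0[of x] trace_mul_sym[of "mat_star x" x] by simp

text \<open>\<open>avg\<close> gives the adjoint of Connes' map in closed form. Evaluated at
  \<open>\<xi>\<close>, each of its terms is a scalar times \<open>f i\<close> applied to
  \<open>\<eta>\<close>, so the operator is an explicit combination of the \<open>f i\<close>, ready
  for a functional on \<open>A\<close>.\<close>

lemma spatial_theta_commutant:
  assumes \<rho>: "\<rho> \<in> commutant A" and \<sigma>: "\<sigma> \<in> commutant A" and inv: "\<rho> ** \<sigma> = mat 1"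
    and \<psi>: "\<And>x. x \<in> commutant A \<Longrightarrow> \<psi> x = trace (\<rho> ** x)"
  shows "spatial_theta (commutant A) \<psi> \<xi> =
    (\<Sum>i\<in>I. mat (cinner \<xi> (mat_star (f i) ** mat_star \<sigma> *v \<xi>)) ** f i)" (is "_ = ?\<theta>")
proof -
  note comm_closed = star_subalgebraD[OF alg_commutant] star_subalgebra_diff[OF alg_commutant]
  \<comment> \<open>The candidate for the adjoint of \<open>R\<close> at \<open>\<eta>\<close>:
    averaging puts \<open>|\<eta>><\<xi>|\<close> into the commutant while keeping its trace
    pairings, and \<open>\<sigma>\<close> cancels the density \<open>\<rho>\<close> of
    \<open>\<psi>\<close>.\<close>
  define y where "y \<eta> = avg (outer \<eta> \<xi>) ** mat_star \<sigma>" for \<eta>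
  have y: "y \<eta> \<in> commutant A" for \<eta>
    by (simp add: y_def comm_closed avg_commutant \<sigma>)
  have theta: "?\<theta> *v \<eta> = y \<eta> *v \<xi>" for \<eta>
  proof -
    have "y \<eta> *v \<xi> = (\<Sum>i\<in>I. f i *v (outer \<eta> \<xi> *v ((mat_star (f i) ** mat_star \<sigma>) *v \<xi>)))"
      by (simp add: y_def avg_def matrix_mult_sum_left matrix_vector_sum_left matrix_vector_mul_assoc
          matrix_mul_assoc)
    also have "\<dots> = ?\<theta> *v \<eta>"
      by (simp add: outer_mult_vec matrix_vector_sum_left vec.scale mat_mult_vec flip: matrix_vector_mul_assoc)
    finally show ?thesis ..
  qed
  have adj: "cinner \<eta> (z *v \<xi>) = \<psi> (mat_star (y \<eta>) ** z)" if z: "z \<in> commutant A" for \<eta> z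
  proof -
    have "\<psi> (mat_star (y \<eta>) ** z) = trace (\<rho> ** \<sigma> ** avg (outer \<xi> \<eta>) ** z)"
      by (subst \<psi>) (auto simp: comm_closed y z, simp add: y_def avg_star mat_star_outer matrix_mul_assoc)
    also have "\<dots> = trace (outer \<xi> \<eta> ** z)"
      using z by (simp add: inv trace_avg_mult)
    also have "\<dots> = trace (z ** outer \<xi> \<eta>)"
      by (rule trace_mul_sym)
    finally show ?thesis
      by (simp add: trace_mult_outer)
  qed
  show ?thesis
    unfolding spatial_theta_def
  proof (rule the_equality)
    show "\<forall>\<eta>. \<exists>y\<in>commutant A. ?\<theta> *v \<eta> = y *v \<xi> \<and> (\<forall>z\<in>commutant A. cinner \<eta> (z *v \<xi>) = \<psi> (mat_star y ** z))"
      using y theta adj by blast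
    fix S assume S: "\<forall>\<eta>. \<exists>y\<in>commutant A. S *v \<eta> = y *v \<xi> \<and> (\<forall>z\<in>commutant A. cinner \<eta> (z *v \<xi>) = \<psi> (mat_star y ** z))"
    show "S = ?\<theta>"
      unfolding matrix_eq
    proof
      fix \<eta>
      obtain x where x: "x \<in> commutant A" "S *v \<eta> = x *v \<xi>"
        "\<And>z. z \<in> commutant A \<Longrightarrow> cinner \<eta> (z *v \<xi>) = \<psi> (mat_star x ** z)"
        using S by blast
      \<comment> \<open>Uniqueness for the definite description: two candidates for the adjoint have
        equal pairings with the commutant, and the pairing is nondegenerate because
        \<open>\<rho>\<close> is invertible.\<close>
      have "trace (\<rho> ** mat_star (x - y \<eta>) ** z) = 0" if z: "z \<in> commutant A" for z
      proof -
        have "trace (\<rho> ** (mat_star x ** z)) = trace (\<rho> ** (mat_star (y \<eta>) ** z))"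
          using x(3)[OF z] adj[OF z, of \<eta>] \<psi> x(1) y z by (simp add: comm_closed)
        then show ?thesis
          by (simp add: matrix_diff_ldistrib matrix_diff_rdistrib matrix_mul_assoc trace_sub)
      qed
      then have "\<rho> ** mat_star (x - y \<eta>) = 0"
        by (intro trace_nondegenerate comm_closed \<rho> x y)
      then have "\<sigma> ** \<rho> ** mat_star (x - y \<eta>) = 0"
        by (simp flip: matrix_mul_assoc)
      moreover have "\<sigma> ** \<rho> = mat 1"
        using inv by (simp add: matrix_left_right_inverse)
      ultimately have "mat_star (x - y \<eta>) = 0"
        by simp
      then have "x = y \<eta>"
        unfolding mat_star_eq_0_iff by simp
      then show "S *v \<eta> = ?\<theta> *v \<eta>"
        using theta x by simp
    qed
  qed
qed

text \<open>The spatial derivative splits into the density of \<open>\<phi>\<close> on the algebra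
  and the inverse density of \<open>\<psi>\<close> on the commutant. No dimension factor remains,
  since \<open>f\<close> and \<open>T\<close> are normalised together.\<close>

lemma spatial_derivative_commutant:
  assumes \<rho>: "\<rho> \<in> commutant A" and \<sigma>: "\<sigma> \<in> commutant A" and inv: "\<rho> ** \<sigma> = mat 1"
    and \<psi>: "\<And>x. x \<in> commutant A \<Longrightarrow> \<psi> x = trace (\<rho> ** x)" and \<phi>: "pos_functional A \<phi>"
  shows "spatial_derivative (commutant A) \<phi> \<psi> = density \<phi> ** mat_star \<sigma>"
proof -
  have theta: "spatial_theta (commutant A) \<psi> \<xi> =
      (\<Sum>i\<in>I. mat (cinner \<xi> (mat_star (f i) ** mat_star \<sigma> *v \<xi>)) ** f i)" for \<xi>
    by (rule spatial_theta_commutant[OF \<rho> \<sigma> inv \<psi>])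
  have form: "\<phi> (spatial_theta (commutant A) \<psi> \<xi>) = cinner \<xi> ((density \<phi> ** mat_star \<sigma>) *v \<xi>)" for \<xi>
  proof -
    have "\<phi> (spatial_theta (commutant A) \<psi> \<xi>) =
        (\<Sum>i\<in>I. \<phi> (mat (cinner \<xi> (mat_star (f i) ** mat_star \<sigma> *v \<xi>)) ** f i))"
      unfolding theta
      by (intro pos_functional_sum[OF \<phi> alg] alg_closed f_in)
    also have "\<dots> = (\<Sum>i\<in>I. \<phi> (f i) * cinner \<xi> (mat_star (f i) ** mat_star \<sigma> *v \<xi>))"
      by (intro sum.cong) (simp_all add: pos_functionalD(2)[OF \<phi>] f_in)
    also have "\<dots> = cinner \<xi> ((density \<phi> ** mat_star \<sigma>) *v \<xi>)"
      by (simp add: density_def matrix_mult_sum_left matrix_vector_sum_left cinner_sum_right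
          mat_mult_vec cinner_scale_right flip: matrix_vector_mul_assoc)
    finally show ?thesis .
  qed
  show ?thesis
    unfolding spatial_derivative_def form
    by (rule the_equality) (auto intro: quadratic_form_inject)
qed

end

section \<open>Matrix units\<close>

lemma sum_delta2:
  fixes g :: "nat \<Rightarrow> nat \<Rightarrow> 'b::comm_monoid_add"
  assumes "j < k" "b < d j"
  shows "(\<Sum>i<k. \<Sum>a<d i. if i = j \<and> a = b then g i a else 0) = g j b"
proof -
  have "(\<Sum>i<k. \<Sum>a<d i. if i = j \<and> a = b then g i a else 0) = (\<Sum>i<k. if i = j then g i b else 0)"
    using assms by (intro sum.cong refl) auto
  then show ?thesis
    using assms by simp
qed

lemma sum_delta3:
  fixes g :: "nat \<Rightarrow> nat \<Rightarrow> nat \<Rightarrow> 'b::comm_monoid_add"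
  assumes "j < k" "b < d j" "c < d j"
  shows "(\<Sum>i<k. \<Sum>a<d i. \<Sum>a'<d i. if i = j \<and> a = b \<and> a' = c then g i a a' else 0) = g j b c"
proof -
  have "(\<Sum>i<k. \<Sum>a<d i. \<Sum>a'<d i. if i = j \<and> a = b \<and> a' = c then g i a a' else 0) =
      (\<Sum>i<k. \<Sum>a<d i. if i = j \<and> a = b then g i a c else 0)"
    using assms by (intro sum.cong refl) auto
  then show ?thesis
    using assms by (simp add: sum_delta2)
qed

locale matrix_units =
  fixes A :: "'n::finite cmat set" and k :: nat and d :: "nat \<Rightarrow> nat"
    and e :: "nat \<Rightarrow> nat \<Rightarrow> nat \<Rightarrow> 'n cmat"
  assumes alg: "star_subalgebra A"
    and d_pos: "i < k \<Longrightarrow> 0 < d i"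
    and e_in: "i < k \<Longrightarrow> a < d i \<Longrightarrow> b < d i \<Longrightarrow> e i a b \<in> A"
    and e_nonzero: "i < k \<Longrightarrow> a < d i \<Longrightarrow> b < d i \<Longrightarrow> e i a b \<noteq> 0"
    and e_star: "i < k \<Longrightarrow> a < d i \<Longrightarrow> b < d i \<Longrightarrow> mat_star (e i a b) = e i b a"
    and e_mult: "i < k \<Longrightarrow> a < d i \<Longrightarrow> b < d i \<Longrightarrow> j < k \<Longrightarrow> a' < d j \<Longrightarrow> b' < d j \<Longrightarrow>
      e i a b ** e j a' b' = (if i = j \<and> b = a' then e i a b' else 0)"
    and e_unit: "(\<Sum>i<k. \<Sum>a<d i. e i a a) = mat 1"
    and e_span: "x \<in> A \<Longrightarrow> \<exists>c. x = (\<Sum>i<k. \<Sum>a<d i. \<Sum>b<d i. mat (c i a b) ** e i a b)"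

text \<open>Elementary matrices are transported along \<open>\<Phi>\<close>. As
  \<open>\<Phi>\<close> is constrained only on the direct sum, every function it is applied to,
  partial sums included, must be shown to vanish out of range.\<close>

lemma multi_matrix_algebra_units:
  assumes "multi_matrix_algebra A"
  obtains k d e where "matrix_units A k d e"
proof -
  obtain k d \<Phi> where d: "\<forall>i<k. 0 < d i" and bij: "bij_betw \<Phi> (matrix_direct_sum k d) A"
    and ops: "\<forall>x\<in>matrix_direct_sum k d. \<forall>y\<in>matrix_direct_sum k d.
           \<Phi> (\<lambda>i a b. x i a b + y i a b) = \<Phi> x + \<Phi> y \<and>
           \<Phi> (\<lambda>i a b. \<Sum>c<d i. x i a c * y i c b) = \<Phi> x ** \<Phi> y"
    and scale: "\<forall>x\<in>matrix_direct_sum k d. \<forall>c. \<Phi> (\<lambda>i a b. c * x i a b) = mat c ** \<Phi> x"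
    and star: "\<forall>x\<in>matrix_direct_sum k d. \<Phi> (\<lambda>i a b. cnj (x i b a)) = mat_star (\<Phi> x)"
    and one: "\<Phi> (\<lambda>i a b. if i < k \<and> a < d i \<and> a = b then 1 else 0) = mat 1"
    using assms unfolding multi_matrix_algebra_def by blast
  let ?D = "matrix_direct_sum k d"
  have add: "\<Phi> (\<lambda>i a b. x i a b + y i a b) = \<Phi> x + \<Phi> y"
    and mult: "\<Phi> (\<lambda>i a b. \<Sum>c<d i. x i a c * y i c b) = \<Phi> x ** \<Phi> y" if "x \<in> ?D" "y \<in> ?D" for x y
    using ops that by blast+
  have in_D: "x \<in> ?D \<longleftrightarrow> (\<forall>i a b. \<not> (i < k \<and> a < d i \<and> b < d i) \<longrightarrow> x i a b = 0)" for x
    by (simp add: matrix_direct_sum_def)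
  have \<Phi>_in: "\<Phi> x \<in> A" if "x \<in> ?D" for x
    using bij that by (auto simp: bij_betw_def)
  have \<Phi>_inj: "x = y" if "\<Phi> x = \<Phi> y" "x \<in> ?D" "y \<in> ?D" for x y
    using bij that by (auto simp: bij_betw_def inj_on_def)
  have \<Phi>_surj: "\<exists>y\<in>?D. x = \<Phi> y" if "x \<in> A" for x
    using bij that by (auto simp: bij_betw_def)
  have zero: "\<Phi> (\<lambda>i a b. 0) = 0"
  proof -
    have "(\<lambda>i a b. 0) \<in> ?D"
      by (simp add: in_D)
    then show ?thesis
      using scale[rule_format, of "\<lambda>i a b. 0" 0] by simp
  qed
  have \<Phi>_sum: "(\<lambda>i a b. \<Sum>s\<in>S. g s i a b) \<in> ?D \<and> \<Phi> (\<lambda>i a b. \<Sum>s\<in>S. g s i a b) = (\<Sum>s\<in>S. \<Phi> (g s))"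
    if "finite S" "\<And>s. s \<in> S \<Longrightarrow> g s \<in> ?D" for S :: "nat set" and g
    using that
  proof (induct S)
    case empty
    then show ?case
      by (simp add: zero in_D)
  next
    case (insert s S)
    then show ?case
      using add[of "g s" "\<lambda>i a b. \<Sum>s\<in>S. g s i a b"] by (simp add: in_D)
  qed
  have alg: "star_subalgebra A"
    unfolding star_subalgebra_def
  proof (intro conjI ballI allI)
    have "(\<lambda>i a b. if i < k \<and> a < d i \<and> a = b then 1 else 0) \<in> ?D"
      by (auto simp: in_D)
    from \<Phi>_in[OF this] show "mat 1 \<in> A"
      unfolding one .
  next
    fix x y assume "x \<in> A" "y \<in> A"
    then obtain x' y' where xy: "x' \<in> ?D" "y' \<in> ?D" "x = \<Phi> x'" "y = \<Phi> y'"
      using \<Phi>_surj by blast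
    have "(\<lambda>i a b. x' i a b + y' i a b) \<in> ?D"
      using xy by (simp add: in_D)
    from \<Phi>_in[OF this] show "x + y \<in> A"
      unfolding add[OF xy(1,2)] xy(3,4) .
    have "(\<lambda>i a b. \<Sum>c<d i. x' i a c * y' i c b) \<in> ?D"
      using xy by (auto simp: in_D intro!: sum.neutral)
    from \<Phi>_in[OF this] show "x ** y \<in> A"
      unfolding mult[OF xy(1,2)] xy(3,4) .
  next
    fix x c assume "x \<in> A"
    then obtain x' where x: "x' \<in> ?D" "x = \<Phi> x'"
      using \<Phi>_surj by blast
    have "(\<lambda>i a b. c * x' i a b) \<in> ?D"
      using x by (simp add: in_D)
    from \<Phi>_in[OF this] show "mat c ** x \<in> A"
      unfolding scale[rule_format, OF x(1)] x(2) .
  next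
    fix x assume "x \<in> A"
    then obtain x' where x: "x' \<in> ?D" "x = \<Phi> x'"
      using \<Phi>_surj by blast
    have "(\<lambda>i a b. cnj (x' i b a)) \<in> ?D"
      using x unfolding in_D by simp blast
    from \<Phi>_in[OF this] show "mat_star x \<in> A"
      unfolding star[rule_format, OF x(1)] x(2) .
  qed
  define u :: "nat \<Rightarrow> nat \<Rightarrow> nat \<Rightarrow> nat \<Rightarrow> nat \<Rightarrow> nat \<Rightarrow> complex" where
    "u i a b = (\<lambda>i' a' b'. if i' = i \<and> a' = a \<and> b' = b then 1 else 0)" for i a b
  have u: "u i a b \<in> ?D" if "i < k" "a < d i" "b < d i" for i a b
    using that by (auto simp: in_D u_def)
  define e where "e i a b = \<Phi> (u i a b)" for i a b
  have "matrix_units A k d e"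
  proof
    show "star_subalgebra A"
      by (rule alg)
  next
    show "0 < d i" if "i < k" for i
      using d that by blast
  next
    fix i a b assume i: "i < k" "a < d i" "b < d i"
    show "e i a b \<in> A"
      using \<Phi>_in u i by (simp add: e_def)
    show "e i a b \<noteq> 0"
    proof
      assume "e i a b = 0"
      then have "u i a b = (\<lambda>i a b. 0)"
        using \<Phi>_inj[of "u i a b" "\<lambda>i a b. 0"] u[OF i] zero by (simp add: e_def in_D)
      from fun_cong[OF fun_cong[OF fun_cong[OF this]], of i a b]
      have "u i a b i a b = 0" .
      then show False
        by (simp add: u_def)
    qed
    have "(\<lambda>i' a' b'. cnj (u i a b i' b' a')) = u i b a"
      by (auto simp: u_def fun_eq_iff)
    then show "mat_star (e i a b) = e i b a"
      using star[rule_format, OF u[OF i]] by (simp add: e_def)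
    fix j a' b' assume j: "j < k" "a' < d j" "b' < d j"
    have "(\<lambda>i' x y. \<Sum>c<d i'. u i a b i' x c * u j a' b' i' c y) =
        (if i = j \<and> b = a' then u i a b' else (\<lambda>i a b. 0))"
    proof (intro ext)
      fix i' x y
      have "(\<Sum>c<d i'. u i a b i' x c * u j a' b' i' c y) =
          (\<Sum>c<d i'. if c = b then (if i' = i \<and> x = a \<and> i' = j \<and> b = a' \<and> y = b' then 1 else 0) else 0)"
        by (intro sum.cong) (auto simp: u_def)
      also have "\<dots> = (if i = j \<and> b = a' then u i a b' else (\<lambda>i a b. 0)) i' x y"
        using i by (auto simp: u_def)
      finally show "(\<Sum>c<d i'. u i a b i' x c * u j a' b' i' c y) =
          (if i = j \<and> b = a' then u i a b' else (\<lambda>i a b. 0)) i' x y" .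
    qed
    then show "e i a b ** e j a' b' = (if i = j \<and> b = a' then e i a b' else 0)"
      unfolding e_def mult[OF u[OF i] u[OF j], symmetric] by (simp add: zero)
  next
    have "(\<lambda>i' a' b'. \<Sum>i<k. \<Sum>a<d i. u i a a i' a' b') =
        (\<lambda>i a b. if i < k \<and> a < d i \<and> a = b then 1 else 0)"
    proof (intro ext)
      fix i' a' b'
      have "(\<Sum>i<k. \<Sum>a<d i. u i a a i' a' b') =
          (\<Sum>i<k. \<Sum>a<d i. if i = i' \<and> a = a' then (if a' = b' then 1 else 0) else 0)"
        by (intro sum.cong) (auto simp: u_def)
      also have "\<dots> = (if i' < k \<and> a' < d i' \<and> a' = b' then 1 else 0)"
      proof (cases "i' < k \<and> a' < d i'")
        case True
        then show ?thesis
          using sum_delta2[of i' k a' d "\<lambda>_ _. if a' = b' then 1 else 0 :: complex"] by simp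
      qed (auto intro!: sum.neutral)
      finally show "(\<Sum>i<k. \<Sum>a<d i. u i a a i' a' b') = (if i' < k \<and> a' < d i' \<and> a' = b' then 1 else 0)" .
    qed
    then have "mat 1 = \<Phi> (\<lambda>i' a' b'. \<Sum>i<k. \<Sum>a<d i. u i a a i' a' b')"
      using one by simp
    also have "\<dots> = (\<Sum>i<k. \<Phi> (\<lambda>i' a' b'. \<Sum>a<d i. u i a a i' a' b'))"
      by (intro \<Phi>_sum[THEN conjunct2] \<Phi>_sum[THEN conjunct1] u) auto
    also have "\<dots> = (\<Sum>i<k. \<Sum>a<d i. e i a a)"
      unfolding e_def by (intro sum.cong refl \<Phi>_sum[THEN conjunct2] u) auto
    finally show "(\<Sum>i<k. \<Sum>a<d i. e i a a) = mat 1" ..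
  next
    fix x assume "x \<in> A"
    then obtain c where c: "c \<in> ?D" "x = \<Phi> c"
      using \<Phi>_surj by blast
    have cu: "(\<lambda>i' a' b'. c i a b * u i a b i' a' b') \<in> ?D" if "i < k" "a < d i" "b < d i" for i a b
      using u[OF that] by (simp add: in_D)
    have "c = (\<lambda>i' a' b'. \<Sum>i<k. \<Sum>a<d i. \<Sum>b<d i. c i a b * u i a b i' a' b')"
    proof (intro ext)
      fix i' a' b'
      have "(\<Sum>i<k. \<Sum>a<d i. \<Sum>b<d i. c i a b * u i a b i' a' b') =
          (\<Sum>i<k. \<Sum>a<d i. \<Sum>b<d i. if i = i' \<and> a = a' \<and> b = b' then c i a b else 0)"
        by (intro sum.cong) (auto simp: u_def)
      also have "\<dots> = c i' a' b'"
      proof (cases "i' < k \<and> a' < d i' \<and> b' < d i'")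
        case True
        then show ?thesis
          using sum_delta3[of i' k a' d b' c] by simp
      next
        case False
        then have "c i' a' b' = 0"
          using c(1) unfolding in_D by blast
        moreover have "(\<Sum>i<k. \<Sum>a<d i. \<Sum>b<d i. if i = i' \<and> a = a' \<and> b = b' then c i a b else 0) = 0"
          using False by (intro sum.neutral ballI) auto
        ultimately show ?thesis
          by simp
      qed
      finally show "c i' a' b' = (\<Sum>i<k. \<Sum>a<d i. \<Sum>b<d i. c i a b * u i a b i' a' b')" ..
    qed
    then have "x = \<Phi> (\<lambda>i' a' b'. \<Sum>i<k. \<Sum>a<d i. \<Sum>b<d i. c i a b * u i a b i' a' b')"
      using c(2) by simp
    also have "\<dots> = (\<Sum>i<k. \<Phi> (\<lambda>i' a' b'. \<Sum>a<d i. \<Sum>b<d i. c i a b * u i a b i' a' b'))"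
      by (intro \<Phi>_sum[THEN conjunct2] \<Phi>_sum[THEN conjunct1] cu) auto
    also have "\<dots> = (\<Sum>i<k. \<Sum>a<d i. \<Phi> (\<lambda>i' a' b'. \<Sum>b<d i. c i a b * u i a b i' a' b'))"
      by (intro sum.cong refl \<Phi>_sum[THEN conjunct2] \<Phi>_sum[THEN conjunct1] cu) auto
    also have "\<dots> = (\<Sum>i<k. \<Sum>a<d i. \<Sum>b<d i. \<Phi> (\<lambda>i' a' b'. c i a b * u i a b i' a' b'))"
      by (intro sum.cong refl \<Phi>_sum[THEN conjunct2] cu) auto
    also have "\<dots> = (\<Sum>i<k. \<Sum>a<d i. \<Sum>b<d i. mat (c i a b) ** e i a b)"
      unfolding e_def by (intro sum.cong refl scale[rule_format] u) auto
    finally show "\<exists>c. x = (\<Sum>i<k. \<Sum>a<d i. \<Sum>b<d i. mat (c i a b) ** e i a b)"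
      by blast
  qed
  then show ?thesis
    by (rule that)
qed

section \<open>The regular trace computed from matrix units\<close>

context matrix_units
begin

text \<open>The rank of a minimal projection of the \<open>i\<close>-th summand, i.e. the
  multiplicity of this summand in the representation on \<open>complex^'n\<close>. The unit
  \<open>e i 0 0\<close> exists by \<open>d_pos\<close> and represents all diagonal units, which are
  equivalent.\<close>

definition mult_trace :: "nat \<Rightarrow> real" where
  "mult_trace i = Re (trace (e i 0 0))"

lemma mult_trace_pos:
  assumes "i < k" shows "mult_trace i > 0"
proof -
  have e: "mat_star (e i 0 0) ** e i 0 0 = e i 0 0"
    using assms d_pos by (simp add: e_star e_mult)
  have "trace (e i 0 0) \<noteq> 0" "trace (e i 0 0) \<in> \<real>\<^sub>\<ge>\<^sub>0"
    using trace_star_mult_self_eq_0[of "e i 0 0"] trace_star_mult_self_nonneg[of "e i 0 0"]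
      e_nonzero[of i 0 0] assms d_pos by (auto simp: e)
  then show ?thesis
    by (auto simp: mult_trace_def complex_nonneg_Reals_iff complex_eq_iff)
qed

lemma trace_e:
  assumes "i < k" "a < d i" "b < d i"
  shows "trace (e i a b) = (if a = b then of_real (mult_trace i) else 0)"
proof (cases "a = b")
  case True
  have "trace (e i a a) = trace (e i a 0 ** e i 0 a)"
    using assms d_pos by (simp add: e_mult)
  also have "\<dots> = trace (e i 0 a ** e i a 0)"
    by (rule trace_mul_sym)
  also have "\<dots> = trace (e i 0 0)"
    using assms d_pos by (simp add: e_mult)
  also have "\<dots> = of_real (mult_trace i)"
  proof -
    have "mat_star (e i 0 0) ** e i 0 0 = e i 0 0"
      using assms d_pos by (simp add: e_star e_mult)
    then show ?thesis
      using trace_star_mult_self_nonneg[of "e i 0 0"]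
      by (simp add: complex_nonneg_Reals_iff complex_eq_iff mult_trace_def)
  qed
  finally show ?thesis
    using True by simp
next
  case False
  have "trace (e i a b) = trace (e i a a ** e i a b)"
    using assms by (simp add: e_mult)
  also have "\<dots> = trace (e i a b ** e i a a)"
    by (rule trace_mul_sym)
  also have "\<dots> = 0"
    using assms False by (simp add: e_mult)
  finally show ?thesis
    using False by simp
qed

text \<open>A minimal projection of the \<open>i\<close>-th summand has ambient trace
  \<open>mult_trace i\<close>, but trace \<open>d i\<close> in the left regular representation; this
  central element corrects the former to the latter.\<close>

definition weight :: "'n cmat" where
  "weight = (\<Sum>i<k. \<Sum>a<d i. mat (of_real (d i / mult_trace i)) ** e i a a)"

definition reg_trace :: "'n cmat \<Rightarrow> complex" where
  "reg_trace x = trace (weight ** x)"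

lemma reg_trace_0: "reg_trace 0 = 0"
  by (simp add: reg_trace_def)

text \<open>Compressions by the diagonal units show \<open>reg_trace\<close> as a positive
  combination of traces, hence nonnegative on all positive semidefinite matrices, also outside
  \<open>A\<close>.\<close>

lemma reg_trace_sum:
  "reg_trace x = (\<Sum>i<k. \<Sum>a<d i. of_real (d i / mult_trace i) * trace (e i a a ** x ** e i a a))"
proof -
  have "trace (e i a a ** x ** e i a a) = trace (e i a a ** x)" if "i < k" "a < d i" for i a
  proof -
    have "trace (e i a a ** x ** e i a a) = trace (e i a a ** (e i a a ** x))"
      by (rule trace_mul_sym)
    then show ?thesis
      using that by (simp add: matrix_mul_assoc e_mult)
  qed
  then show ?thesis
    by (simp add: reg_trace_def weight_def matrix_mult_sum_left trace_sum trace_scale flip: matrix_mul_assoc)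
qed

lemma weight_central:
  assumes "x \<in> A" shows "weight ** x = x ** weight"
proof -
  have left: "weight ** e j b c = mat (of_real (d j / mult_trace j)) ** e j b c"
    if j: "j < k" "b < d j" "c < d j" for j b c
  proof -
    have "weight ** e j b c =
        (\<Sum>i<k. \<Sum>a<d i. if i = j \<and> a = b then mat (of_real (d i / mult_trace i)) ** e i a c else 0)"
      unfolding weight_def matrix_mult_sum_left
      using j by (intro sum.cong) (auto simp: e_mult simp flip: matrix_mul_assoc)
    then show ?thesis
      using sum_delta2[of j k b d "\<lambda>i a. mat (of_real (d i / mult_trace i)) ** e i a c"] j by simp
  qed
  have right: "e j b c ** weight = mat (of_real (d j / mult_trace j)) ** e j b c"
    if j: "j < k" "b < d j" "c < d j" for j b c
  proof -
    have "e j b c ** weight =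
        (\<Sum>i<k. \<Sum>a<d i. if i = j \<and> a = c then mat (of_real (d i / mult_trace i)) ** e i b a else 0)"
      unfolding weight_def matrix_mult_sum_right
      using j by (intro sum.cong) (auto simp: e_mult mult_mat_left_commute)
    then show ?thesis
      using sum_delta2[of j k c d "\<lambda>i a. mat (of_real (d i / mult_trace i)) ** e i b a"] j by simp
  qed
  obtain c where c: "x = (\<Sum>i<k. \<Sum>a<d i. \<Sum>b<d i. mat (c i a b) ** e i a b)"
    using e_span[OF assms] by blast
  show ?thesis
    unfolding c matrix_mult_sum_left matrix_mult_sum_right mult_mat_left_commute
    by (intro sum.cong refl) (simp add: left right flip: matrix_mul_assoc)
qed

lemma reg_trace_e:
  assumes j: "j < k" "b < d j" "c < d j"
  shows "reg_trace (e j b c) = (if b = c then of_nat (d j) else 0)"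
proof -
  have "reg_trace (e j b c) =
      (\<Sum>i<k. \<Sum>a<d i. if i = j \<and> a = b then of_real (d i / mult_trace i) * trace (e i a c) else 0)"
    unfolding reg_trace_def weight_def matrix_mult_sum_left trace_sum
    using j by (intro sum.cong refl) (auto simp: e_mult trace_scale simp flip: matrix_mul_assoc)
  also have "\<dots> = of_real (d j / mult_trace j) * trace (e j b c)"
    using sum_delta2[of j k b d "\<lambda>i a. of_real (d i / mult_trace i) * trace (e i a c)"] j by simp
  also have "\<dots> = (if b = c then of_nat (d j) else 0)"
    using mult_trace_pos[of j] j by (simp add: trace_e)
  finally show ?thesis .
qed

text \<open>Under \<open>reg_trace\<close> a unit of the \<open>i\<close>-th summand has squared
  length \<open>d i\<close>, which fixes the factor \<open>1 / sqrt (d i)\<close>. The same factor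
  gives \<open>f_fstar\<close> and \<open>fstar_f\<close>, because each diagonal unit occurs
  \<open>d i\<close> times in either sum.\<close>

lemma regular_trace:
  "regular_trace A (SIGMA i:{..<k}. {..<d i} \<times> {..<d i})
     (\<lambda>(i, a, b). mat (of_real (1 / sqrt (d i))) ** e i a b) reg_trace"
    (is "regular_trace A ?I ?f reg_trace")
proof
  have sum_I: "(\<Sum>p\<in>?I. g p) = (\<Sum>i<k. \<Sum>a<d i. \<Sum>b<d i. g (i, a, b))"
    for g :: "nat \<times> nat \<times> nat \<Rightarrow> 'n cmat"
    by (simp add: sum.Sigma sum.cartesian_product case_prod_beta)
  show "star_subalgebra A"
    by (rule alg)
  show "finite ?I"
    by auto
  show "?f p \<in> A" if "p \<in> ?I" for p
    using that by (auto intro!: star_subalgebraD[OF alg] e_in)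
  show add: "reg_trace (x + y) = reg_trace x + reg_trace y" for x y
    by (simp add: reg_trace_def matrix_add_ldistrib trace_add)
  show scale: "reg_trace (mat c ** x) = c * reg_trace x" for c x
    by (simp add: reg_trace_def mult_mat_left_commute trace_scale)
  show "reg_trace (x ** y) = reg_trace (y ** x)" if "x \<in> A" "y \<in> A" for x y
  proof -
    have "reg_trace (x ** y) = trace (x ** (weight ** y))"
      by (simp add: reg_trace_def weight_central[OF that(1)] matrix_mul_assoc)
    also have "\<dots> = trace (weight ** y ** x)"
      by (rule trace_mul_sym)
    finally show ?thesis
      by (simp add: reg_trace_def matrix_mul_assoc)
  qed
  have conj: "e i a a ** x ** e i a a = e i a a ** x ** mat_star (e i a a)"
    if "i < k" "a < d i" for i a x
    using that by (simp add: e_star)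
  have nonneg: "of_real (d i / mult_trace i) * trace (e i a a ** x ** e i a a) \<in> \<real>\<^sub>\<ge>\<^sub>0"
    if "psd x" "i < k" "a < d i" for x i a
    unfolding conj[OF that(2,3)]
    using that mult_trace_pos[of i] by (intro nonneg_Reals_mult_I trace_psd_nonneg psd_conj) auto
  then show "reg_trace x \<in> \<real>\<^sub>\<ge>\<^sub>0" if "psd x" for x
    unfolding reg_trace_sum using that by (auto simp: complex_nonneg_Reals_iff intro!: sum_nonneg sum.neutral)
  show "x = 0" if x: "reg_trace (mat_star x ** x) = 0" for x
  proof -
    have "x ** e i a a = 0" if i: "i < k" "a < d i" for i a
    proof -
      have psd: "psd (mat_star x ** x)"
        using psd_mult_star[of "mat_star x"] by simp
      let ?g = "\<lambda>i a. Re (of_real (d i / mult_trace i) * trace (e i a a ** (mat_star x ** x) ** e i a a))"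
      have g: "?g i a \<ge> 0" if "i < k" "a < d i" for i a
        using nonneg[OF psd that] by (simp only: complex_nonneg_Reals_iff)
      have "(\<Sum>i<k. \<Sum>a<d i. ?g i a) = 0"
        using x unfolding reg_trace_sum by (simp only: Re_sum[symmetric] zero_complex.sel)
      then have "(\<Sum>a<d i. ?g i a) = 0"
        using i g by (subst (asm) sum_nonneg_eq_0_iff) (auto intro: sum_nonneg)
      then have "?g i a = 0"
        using i g by (subst (asm) sum_nonneg_eq_0_iff) auto
      moreover have "e i a a ** (mat_star x ** x) ** e i a a = mat_star (x ** e i a a) ** (x ** e i a a)"
        using i by (simp add: e_star matrix_mul_assoc)
      ultimately have "Re (trace (mat_star (x ** e i a a) ** (x ** e i a a))) = 0"
        using i mult_trace_pos[of i] d_pos[of i] by simp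
      then have "trace (mat_star (x ** e i a a) ** (x ** e i a a)) = 0"
        using trace_star_mult_self_nonneg[of "x ** e i a a"]
        by (simp only: complex_nonneg_Reals_iff complex_eq_iff zero_complex.sel)
      then show ?thesis
        by (simp only: trace_star_mult_self_eq_0)
    qed
    then have "x ** (\<Sum>i<k. \<Sum>a<d i. e i a a) = 0"
      by (simp add: matrix_mult_sum_right)
    then show "x = 0"
      by (simp add: e_unit)
  qed
  show "(\<Sum>p\<in>?I. mat (reg_trace (mat_star (?f p) ** x)) ** ?f p) = x" if "x \<in> A" for x
  proof -
    have units: "(\<Sum>p\<in>?I. mat (reg_trace (mat_star (?f p) ** e j b c)) ** ?f p) = e j b c"
      if j: "j < k" "b < d j" "c < d j" for j b c
    proof -
      have "mat (reg_trace (mat_star (?f (i, a, a')) ** e j b c)) ** ?f (i, a, a') =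
          (if i = j \<and> a = b \<and> a' = c then e i a a' else 0)" if i: "i < k" "a < d i" "a' < d i" for i a a'
      proof -
        have "mat_star (?f (i, a, a')) ** e j b c =
            mat (of_real (1 / sqrt (d i))) ** (if i = j \<and> a = b then e i a' c else 0)"
          using i j unfolding prod.case mat_star_scale e_star[OF i] matrix_mul_assoc[symmetric]
          by (subst e_mult) auto
        then have coeff: "reg_trace (mat_star (?f (i, a, a')) ** e j b c) =
            (if i = j \<and> a = b \<and> a' = c then of_real (1 / sqrt (d i)) * of_nat (d i) else 0)"
          using i j by (simp only: scale) (auto simp: reg_trace_e reg_trace_0)
        have "complex_of_real (1 / sqrt (d i)) * of_nat (d i) * of_real (1 / sqrt (d i)) =
            of_real (1 / sqrt (d i) * d i * (1 / sqrt (d i)))"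
          by (simp only: of_real_mult of_real_of_nat_eq)
        also have "1 / sqrt (d i) * d i * (1 / sqrt (d i)) = 1"
          using d_pos[OF i(1)] by (simp add: field_simps)
        finally have unit: "complex_of_real (1 / sqrt (d i)) * of_nat (d i) * of_real (1 / sqrt (d i)) = 1"
          by simp
        show ?thesis
        proof (cases "i = j \<and> a = b \<and> a' = c")
          case True
          show ?thesis
            unfolding coeff if_P[OF True]
            unfolding prod.case matrix_mul_assoc mat_mult unit matrix_mul_lid ..
        next
          case False
          show ?thesis
            unfolding coeff if_not_P[OF False] by simp
        qed
      qed
      then have "(\<Sum>p\<in>?I. mat (reg_trace (mat_star (?f p) ** e j b c)) ** ?f p) =
          (\<Sum>i<k. \<Sum>a<d i. \<Sum>a'<d i. if i = j \<and> a = b \<and> a' = c then e i a a' else 0)"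
        unfolding sum_I by (intro sum.cong refl) blast
      then show ?thesis
        using sum_delta3[of j k b d c e] j by simp
    qed
    define F where "F = ?f"
    \<comment> \<open>\<open>P\<close> is linear and fixes every matrix unit, so it is the identity
      on their span.\<close>
    define P where "P x = (\<Sum>p\<in>?I. mat (reg_trace (mat_star (F p) ** x)) ** F p)" for x
    have P_add: "P (x + y) = P x + P y" for x y
      by (simp add: P_def matrix_add_ldistrib add mat_add matrix_add_rdistrib sum.distrib)
    have P_scale: "P (mat c ** x) = mat c ** P x" for c x
      unfolding P_def mult_mat_left_commute[of "mat_star _"] scale matrix_mult_sum_right
      by (simp add: matrix_mul_assoc mat_mult)
    have P_0: "P 0 = 0"
      using P_scale[of 0 0] by simp
    have P_sum: "P (\<Sum>s\<in>S. g s) = (\<Sum>s\<in>S. P (g s))" for S :: "nat set" and g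
      by (induct S rule: infinite_finite_induct) (simp_all add: P_0 P_add)
    obtain c where c: "x = (\<Sum>i<k. \<Sum>a<d i. \<Sum>b<d i. mat (c i a b) ** e i a b)"
      using e_span[OF \<open>x \<in> A\<close>] by blast
    have "P x = x"
      unfolding c P_sum P_scale by (intro sum.cong refl) (simp only: P_def F_def units lessThan_iff)
    then show ?thesis
      unfolding P_def F_def .
  qed
  have f_mult: "?f (i, a, b) ** mat_star (?f (i, a, b)) = (1 / d i) *\<^sub>R e i a a"
    "mat_star (?f (i, a, b)) ** ?f (i, a, b) = (1 / d i) *\<^sub>R e i b b"
    if "i < k" "a < d i" "b < d i" for i a b
  proof -
    have "mat (of_real r) ** x ** (mat (of_real r) ** y) = (r * r) *\<^sub>R (x ** y)"
      for x y :: "'n cmat" and r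
      unfolding matrix_mul_assoc[symmetric] mult_mat_left_commute[of x]
      by (simp only: mat_of_real_mult scaleR_scaleR)
    moreover have "1 / sqrt (d i) * (1 / sqrt (d i)) = 1 / d i"
      by simp
    ultimately have "mat (of_real (1 / sqrt (d i))) ** x ** (mat (of_real (1 / sqrt (d i))) ** y) =
        (1 / d i) *\<^sub>R (x ** y)" for x y :: "'n cmat"
      by metis
    then show "?f (i, a, b) ** mat_star (?f (i, a, b)) = (1 / d i) *\<^sub>R e i a a"
      "mat_star (?f (i, a, b)) ** ?f (i, a, b) = (1 / d i) *\<^sub>R e i b b"
      using that unfolding prod.case mat_star_scale complex_cnj_complex_of_real
      by (simp_all only: e_star e_mult simp_thms if_True)
  qed
  show "(\<Sum>p\<in>?I. ?f p ** mat_star (?f p)) = mat 1"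
  proof -
    have "(\<Sum>p\<in>?I. ?f p ** mat_star (?f p)) = (\<Sum>i<k. \<Sum>a<d i. \<Sum>b<d i. (1 / d i) *\<^sub>R e i a a)"
      unfolding sum_I by (intro sum.cong refl f_mult(1)) auto
    also have "\<dots> = (\<Sum>i<k. \<Sum>a<d i. e i a a)"
      using d_pos by (intro sum.cong refl) (auto simp: sum_constant_scaleR simp del: sum_constant)
    finally show ?thesis
      by (simp add: e_unit)
  qed
  show "(\<Sum>p\<in>?I. mat_star (?f p) ** ?f p) = mat 1"
  proof -
    have "(\<Sum>p\<in>?I. mat_star (?f p) ** ?f p) = (\<Sum>i<k. \<Sum>a<d i. \<Sum>b<d i. (1 / d i) *\<^sub>R e i b b)"
      unfolding sum_I by (intro sum.cong refl f_mult(2)) auto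
    also have "\<dots> = (\<Sum>i<k. \<Sum>b<d i. \<Sum>a<d i. (1 / d i) *\<^sub>R e i b b)"
      by (intro sum.cong refl sum.swap)
    also have "\<dots> = (\<Sum>i<k. \<Sum>a<d i. e i a a)"
      using d_pos by (intro sum.cong refl) (auto simp: sum_constant_scaleR simp del: sum_constant)
    finally show ?thesis
      by (simp add: e_unit)
  qed
qed

end

lemma multi_matrix_algebra_regular_trace:
  assumes "multi_matrix_algebra A"
  obtains I :: "(nat \<times> nat \<times> nat) set" and f T where "regular_trace A I f T"
proof -
  obtain k d e where "matrix_units A k d e"
    using multi_matrix_algebra_units[OF assms] .
  then show ?thesis
    by (rule that[OF matrix_units.regular_trace])
qed

section \<open>The index of an inclusion\<close>

lemma op_valued_weightD:
  assumes "op_valued_weight A B G"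
  shows "x \<in> A \<Longrightarrow> G x \<in> B" "x \<in> A \<Longrightarrow> y \<in> A \<Longrightarrow> G (x + y) = G x + G y"
    "x \<in> A \<Longrightarrow> G (mat c ** x) = mat c ** G x" "x \<in> A \<Longrightarrow> psd (G (mat_star x ** x))"
    "x \<in> A \<Longrightarrow> b \<in> B \<Longrightarrow> b' \<in> B \<Longrightarrow> G (b ** x ** b') = b ** G x ** b'"
    "x \<in> A \<Longrightarrow> G (mat_star x ** x) = 0 \<Longrightarrow> x = 0"
  using assms unfolding op_valued_weight_def by auto

lemma faithful_functional_trace_compose:
  assumes "op_valued_weight A B G"
  shows "faithful_functional A (trace \<circ> G)"
proof -
  have "trace (G (mat_star x ** x)) \<in> \<real>\<^sub>\<ge>\<^sub>0" "trace (G (mat_star x ** x)) = 0 \<Longrightarrow> x = 0"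
    if "x \<in> A" for x
    using op_valued_weightD(4,6)[OF assms that] trace_psd_nonneg trace_psd_eq_0 by blast+
  then show ?thesis
    using op_valued_weightD(2,3)[OF assms]
    by (simp add: faithful_functional_def pos_functional_def trace_add trace_scale)
qed

text \<open>The density \<open>\<rho>\<close> of \<open>\<psi>\<close> also represents
  \<open>\<psi> \<circ> avg\<close> on all matrices. Since \<open>\<rho>\<close> is bounded below by
  some \<open>l > 0\<close>, the value at \<open>mat_star x ** x\<close> dominates \<open>l\<close>
  times the squared Hilbert-Schmidt norm of \<open>x\<close>.\<close>

lemma (in regular_trace) faithful_functional_compose_avg:
  assumes \<psi>: "faithful_functional (commutant A) \<psi>"
  shows "faithful_functional UNIV (\<psi> \<circ> avg)"
proof -
  note pos = faithful_functional_pos[OF \<psi>]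
  obtain \<rho> where \<rho>: "\<rho> \<in> commutant A" "\<And>x. x \<in> commutant A \<Longrightarrow> \<psi> x = trace (\<rho> ** x)"
    using commutant_density[OF pos] by blast
  obtain l where l: "mat_star \<rho> = \<rho>" "l > 0" "\<And>w. Re (cinner w (\<rho> *v w)) \<ge> l * (norm w)\<^sup>2"
    using density_lower_bound[OF alg_commutant faithful_functional_trace _ \<rho>(1) pos \<rho>(2)] trace_mul_sym \<psi>
    by metis
  have psd: "psd (\<rho> - mat (of_real l))"
    unfolding psd_iff using l
    by (auto simp: matrix_vector_mult_diff_rdistrib mat_mult_vec cinner_diff_right cinner_scale_right
        cinner_self simp del: of_real_power)
  have form: "\<psi> (avg (mat_star x ** x)) = trace (x ** (\<rho> - mat (of_real l)) ** mat_star x) + of_real l * trace (mat_star x ** x)"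
    for x
  proof -
    have "\<psi> (avg (mat_star x ** x)) = trace (\<rho> ** avg (mat_star x ** x))"
      by (rule \<rho>(2)[OF avg_commutant])
    also have "\<dots> = trace (avg (mat_star x ** x) ** \<rho>)"
      by (rule trace_mul_sym)
    also have "\<dots> = trace (mat_star x ** (x ** \<rho>))"
      using trace_avg_mult[OF \<rho>(1)] by (simp add: matrix_mul_assoc)
    also have "\<dots> = trace (mat_star x ** (x ** (\<rho> - mat (of_real l)))) + of_real l * trace (mat_star x ** x)"
      by (simp add: matrix_diff_ldistrib trace_sub mat_central[of x] mult_mat_left_commute trace_scale)
    also have "trace (mat_star x ** (x ** (\<rho> - mat (of_real l)))) = trace (x ** (\<rho> - mat (of_real l)) ** mat_star x)"
      by (rule trace_mul_sym)
    finally show ?thesis .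
  qed
  have nonneg: "trace (x ** (\<rho> - mat (of_real l)) ** mat_star x) \<in> \<real>\<^sub>\<ge>\<^sub>0" for x
    by (intro trace_psd_nonneg psd_conj psd)
  show ?thesis
    unfolding faithful_functional_def pos_functional_def
  proof (intro conjI ballI allI impI)
    fix x y :: "'n cmat" and c
    show "(\<psi> \<circ> avg) (x + y) = (\<psi> \<circ> avg) x + (\<psi> \<circ> avg) y"
      "(\<psi> \<circ> avg) (mat c ** x) = c * (\<psi> \<circ> avg) x"
      using pos_functionalD[OF pos] avg_commutant by (simp_all add: avg_add avg_scale)
    show "(\<psi> \<circ> avg) (mat_star x ** x) \<in> \<real>\<^sub>\<ge>\<^sub>0"
      unfolding o_apply form using l(2)
      by (intro nonneg_Reals_add_I nonneg nonneg_Reals_mult_I trace_star_mult_self_nonneg) auto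
  next
    fix x assume "(\<psi> \<circ> avg) (mat_star x ** x) = 0"
    then have "Re (trace (x ** (\<rho> - mat (of_real l)) ** mat_star x)) + l * Re (trace (mat_star x ** x)) = 0"
      unfolding o_apply form by (simp add: complex_eq_iff)
    moreover have "Re (trace (x ** (\<rho> - mat (of_real l)) ** mat_star x)) \<ge> 0" "Re (trace (mat_star x ** x)) \<ge> 0"
      using nonneg[of x] trace_star_mult_self_nonneg[of x] by (auto simp: complex_nonneg_Reals_iff)
    ultimately have "Re (trace (mat_star x ** x)) = 0"
      using l(2) by (smt (verit) mult_pos_pos)
    then have "trace (mat_star x ** x) = 0"
      using trace_star_mult_self_nonneg[of x] by (simp add: complex_nonneg_Reals_iff complex_eq_iff)
    then show "x = 0"
      by (simp only: trace_star_mult_self_eq_0)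
  qed
qed

locale regular_inclusion =
  sub: regular_trace N J u S + amb: regular_trace M I f T
  for N :: "'n::finite cmat set" and J :: "'j set" and u S
    and M :: "'n cmat set" and I :: "'i set" and f T +
  assumes subset: "N \<subseteq> M"
begin

lemma commutant_subset: "commutant M \<subseteq> commutant N"
  using subset by (rule commutant_antimono)

lemma relative_commutant_closed:
  "x \<in> commutant N \<inter> M \<Longrightarrow> y \<in> commutant N \<inter> M \<Longrightarrow> x - y \<in> commutant N \<inter> M"
  "x \<in> commutant N \<inter> M \<Longrightarrow> y \<in> commutant N \<inter> M \<Longrightarrow> x ** y \<in> commutant N \<inter> M"
  "x \<in> commutant N \<inter> M \<Longrightarrow> mat c ** x \<in> commutant N \<inter> M"
  "x \<in> commutant N \<inter> M \<Longrightarrow> mat_star x \<in> commutant N \<inter> M"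
  "mat c \<in> commutant N \<inter> M"
  using star_subalgebra_diff[OF sub.alg_commutant] star_subalgebraD[OF sub.alg_commutant]
    star_subalgebra_mat[OF sub.alg_commutant] amb.alg_closed by auto

lemma pos_functional_S_compose:
  assumes "op_valued_weight M N E" shows "pos_functional M (S \<circ> E)"
  using op_valued_weightD[OF assms] by (auto simp: pos_functional_def sub.T_add sub.T_scale sub.T_psd)

text \<open>The derivative of \<open>S \<circ> E\<close> with respect to \<open>T\<close>. It
  determines \<open>E\<close> on \<open>M\<close>, by \<open>expectation_expansion\<close>.\<close>

definition rel_density :: "('n cmat \<Rightarrow> 'n cmat) \<Rightarrow> 'n cmat" where
  "rel_density E = amb.density (S \<circ> E)"

lemma rel_density:
  assumes "op_valued_weight M N E" "x \<in> M"
  shows "S (E x) = T (rel_density E ** x)"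
  using amb.density[OF pos_functional_S_compose[OF assms(1)] assms(2)] by (simp add: rel_density_def)

text \<open>The defining identity is used at \<open>\<phi> = S\<close> and
  \<open>\<psi> = trace\<close> only. There it says that the density of \<open>S \<circ> E\<close>
  is the inverse of the density \<open>\<rho>\<close> of \<open>trace \<circ> F\<close>. The first
  lies in \<open>M\<close> and the second in \<open>commutant N\<close>, so both lie in the relative
  commutant; \<open>F\<close> is then recovered from its trace pairings with
  \<open>commutant M\<close>.\<close>

lemma kosaki_structure:
  assumes E: "op_valued_weight M N E" and F: "kosaki_inverse N M E F"
  obtains \<rho> where "\<rho> \<in> commutant N \<inter> M" "rel_density E ** \<rho> = mat 1" "\<rho> ** rel_density E = mat 1"
    "mat_star \<rho> = \<rho>" "rel_density E \<in> commutant N \<inter> M" "\<And>x. x \<in> commutant N \<Longrightarrow> F x = amb.avg (\<rho> ** x)"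
proof -
  note comm_alg = sub.alg_commutant amb.alg_commutant
  have F_weight: "op_valued_weight (commutant N) (commutant M) F"
    using F by (simp add: kosaki_inverse_def)
  note F_rules = op_valued_weightD[OF F_weight]
  have faith: "faithful_functional (commutant N) (trace \<circ> F)"
    using faithful_functional_trace_compose[OF F_weight] .
  obtain \<rho> where \<rho>: "\<rho> \<in> commutant N" "\<And>x. x \<in> commutant N \<Longrightarrow> (trace \<circ> F) x = trace (\<rho> ** x)"
    using sub.commutant_density[OF faithful_functional_pos[OF faith]] by blast
  obtain \<sigma> where \<sigma>: "\<sigma> \<in> commutant N" "\<rho> ** \<sigma> = mat 1" "\<sigma> ** \<rho> = mat 1"
    by (rule density_invertible[OF comm_alg(1) faithful_functional_trace trace_mul_sym \<rho>(1) faith \<rho>(2)])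
  have herm: "mat_star \<rho> = \<rho>"
    by (rule density_lower_bound[OF comm_alg(1) faithful_functional_trace trace_mul_sym \<rho>(1)
          faithful_functional_pos[OF faith] \<rho>(2)])
  have "spatial_derivative (commutant M) (S \<circ> E) trace = spatial_derivative (commutant N) S (trace \<circ> F)"
    using F sub.T_faithful_functional[OF subset_refl] faithful_functional_trace
    unfolding kosaki_inverse_def by blast
  moreover have "spatial_derivative (commutant M) (S \<circ> E) trace = rel_density E ** mat_star (mat 1)"
    unfolding rel_density_def
    by (rule amb.spatial_derivative_commutant[where \<rho> = "mat 1"])
       (simp_all add: star_subalgebraD[OF comm_alg(2)] pos_functional_S_compose[OF E])
  moreover have "spatial_derivative (commutant N) S (trace \<circ> F) = sub.density S ** mat_star \<sigma>"
    by (rule sub.spatial_derivative_commutant[OF \<rho>(1) \<sigma>(1,2) \<rho>(2) sub.T_pos_functional]) simp_all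
  ultimately have k: "rel_density E = mat_star \<sigma>"
    by (simp add: sub.density_T)
  have "mat_star \<sigma> = \<sigma>"
  proof -
    have "\<rho> ** mat_star \<sigma> = mat 1"
      using arg_cong[OF \<sigma>(3), of mat_star] herm by simp
    then have "\<sigma> ** (\<rho> ** mat_star \<sigma>) = \<sigma>"
      by simp
    then show ?thesis
      by (simp add: matrix_mul_assoc \<sigma>)
  qed
  then have k: "rel_density E = \<sigma>"
    using k by simp
  have k_in: "rel_density E \<in> M"
    by (simp add: rel_density_def amb.density_in)
  then have "\<rho> \<in> M"
    using star_subalgebra_inverse[OF amb.alg, of \<sigma> \<rho>] \<sigma> k by simp
  moreover have "F x = amb.avg (\<rho> ** x)" if x: "x \<in> commutant N" for x
  proof -
    have "trace ((F x - amb.avg (\<rho> ** x)) ** y) = 0" if y: "y \<in> commutant M" for y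
    proof -
      have yN: "y \<in> commutant N"
        using y commutant_subset by blast
      have "F x ** y = F (mat 1 ** x ** y)"
        using F_rules(5)[of x "mat 1" y] x y star_subalgebraD[OF comm_alg(2)] by simp
      then have "trace (F x ** y) = (trace \<circ> F) (x ** y)"
        by simp
      also have "\<dots> = trace (\<rho> ** x ** y)"
        using \<rho>(2)[of "x ** y"] x yN star_subalgebraD[OF comm_alg(1)] by (simp add: matrix_mul_assoc)
      also have "\<dots> = trace (amb.avg (\<rho> ** x) ** y)"
        using amb.trace_avg_mult[OF y] by simp
      finally show ?thesis
        by (simp add: matrix_diff_rdistrib trace_sub)
    qed
    then have "F x - amb.avg (\<rho> ** x) = 0"
      by (intro amb.trace_nondegenerate star_subalgebra_diff[OF comm_alg(2)] F_rules(1) x amb.avg_commutant)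
    then show ?thesis
      by simp
  qed
  ultimately show ?thesis
    using that[of \<rho>] \<rho>(1) \<sigma> k k_in herm by simp
qed

text \<open>
  Evaluate the positive functional \<open>T(k \<cdot>)\<close> at \<open>(\<rho> - c)\<^sup>2\<close>, where \<open>k = \<rho>\<^sup>-\<^sup>1\<close> is the density of \<open>S \<circ> E\<close>
  and \<open>c = T(1) / S(1)\<close>; this uses \<open>T(k) = S(1)\<close> and \<open>T(\<rho>) = T(F(1))\<close>.
\<close>

lemma index_lower_bound:
  assumes E: "E \<in> cond_expectations M N" and F: "kosaki_inverse N M E F"
  shows "Re (T (mat 1)) / Re (S (mat 1)) \<le> op_norm (F (mat 1))"
proof -
  have E': "op_valued_weight M N E" "E (mat 1) = mat 1"
    using E by (auto simp: cond_expectations_def)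
  define k where "k = rel_density E"
  obtain \<rho> where \<rho>: "\<rho> \<in> commutant N \<inter> M" "k ** \<rho> = mat 1" "\<rho> ** k = mat 1" "mat_star \<rho> = \<rho>"
    and F_eq: "\<And>x. x \<in> commutant N \<Longrightarrow> F x = amb.avg (\<rho> ** x)"
    using kosaki_structure[OF E'(1) F] unfolding k_def by metis
  have F_1: "F (mat 1) = amb.avg \<rho>"
    using F_eq[of "mat 1"] star_subalgebraD(1)[OF sub.alg_commutant] by simp
  define t where "t = Re (T (mat 1))"
  define s where "s = Re (S (mat 1))"
  \<comment> \<open>This value minimises the quadratic
    \<open>Re (T \<rho>) - 2 * c * t + c\<^sup>2 * s\<close> obtained below.\<close>
  define c where "c = t / s"
  have t: "T (mat 1) = of_real t" "t > 0" and s: "S (mat 1) = of_real s" "s > 0"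
    using amb.T_1_pos sub.T_1_pos by (auto simp: t_def s_def)
  have T_k: "T k = of_real s"
    using rel_density[OF E'(1), of "mat 1"] E'(2) s amb.alg_closed by (simp add: k_def)
  have "0 \<le> Re (S (E (mat_star (\<rho> - mat (of_real c)) ** (\<rho> - mat (of_real c)))))"
  proof -
    have "psd (E (mat_star (\<rho> - mat (of_real c)) ** (\<rho> - mat (of_real c))))"
      using \<rho>(1) by (intro op_valued_weightD(4)[OF E'(1)] amb.alg_closed) auto
    then show ?thesis
      using sub.T_psd by (simp only: complex_nonneg_Reals_iff)
  qed
  also have "S (E (mat_star (\<rho> - mat (of_real c)) ** (\<rho> - mat (of_real c)))) =
      T (k ** (mat_star (\<rho> - mat (of_real c)) ** (\<rho> - mat (of_real c))))"
    using \<rho>(1) unfolding k_def by (intro rel_density[OF E'(1)] amb.alg_closed) auto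
  also have "k ** (mat_star (\<rho> - mat (of_real c)) ** (\<rho> - mat (of_real c))) =
      \<rho> + mat (of_real (- 2 * c)) ** mat 1 + mat (of_real (c\<^sup>2)) ** k"
  proof -
    have "k ** (mat_star (\<rho> - mat (of_real c)) ** (\<rho> - mat (of_real c))) =
        (mat 1 - mat (of_real c) ** k) ** (\<rho> - mat (of_real c))"
      using \<rho> by (simp add: matrix_mul_assoc matrix_diff_ldistrib mat_central[of k])
    also have "\<dots> = \<rho> - mat (of_real c) - (mat (of_real c) ** (k ** \<rho>) - mat (of_real c) ** (mat (of_real c) ** k))"
      by (simp add: matrix_diff_ldistrib matrix_diff_rdistrib mat_central[of k] flip: matrix_mul_assoc)
    also have "\<dots> = \<rho> + mat (of_real (- 2 * c)) ** mat 1 + mat (of_real (c\<^sup>2)) ** k"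
    proof -
      have "mat (of_real c) = c *\<^sub>R (mat 1 :: 'n cmat)"
        by (simp flip: mat_of_real_mult)
      then show ?thesis
        unfolding \<rho>(2) mat_of_real_mult
        by (simp add: vec_eq_iff scaleR_conv_of_real power2_eq_square algebra_simps)
    qed
    finally show ?thesis .
  qed
  also have "Re (T \<dots>) = Re (T \<rho>) - 2 * c * t + c\<^sup>2 * s"
    unfolding amb.T_add amb.T_scale t T_k by simp
  finally have "t\<^sup>2 / s \<le> Re (T \<rho>)"
    using s by (simp add: c_def power2_eq_square field_simps)
  also have "T \<rho> = T (F (mat 1))"
    unfolding F_1 using \<rho>(1)
    by (intro amb.T_avg[symmetric] amb.T_pos_functional amb.tracial) auto
  also have "Re (T (F (mat 1))) \<le> op_norm (F (mat 1)) * t"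
  proof -
    let ?X = "mat (of_real (op_norm (F (mat 1)))) - F (mat 1)"
    have "psd (F (mat_star (mat 1) ** mat 1))"
      using F star_subalgebraD(1)[OF sub.alg_commutant]
      unfolding kosaki_inverse_def op_valued_weight_def by blast
    then have "psd ?X"
      by (intro psd_op_norm_diff) simp
    then have "0 \<le> Re (T ?X)"
      using amb.T_psd by (simp only: complex_nonneg_Reals_iff)
    moreover have "of_real (op_norm (F (mat 1)) * t) = T ?X + T (F (mat 1))"
      using amb.T_scale[of "of_real (op_norm (F (mat 1)))" "mat 1"] t
      by (subst amb.T_add[symmetric]) simp
    from arg_cong[OF this, of Re] have "op_norm (F (mat 1)) * t = Re (T ?X) + Re (T (F (mat 1)))"
      by simp
    ultimately show ?thesis
      by linarith
  qed
  finally have "t\<^sup>2 / s \<le> op_norm (F (mat 1)) * t" .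
  then have "t / s * t \<le> op_norm (F (mat 1)) * t"
    by (simp add: power2_eq_square)
  then show ?thesis
    using t(2) unfolding t_def[symmetric] s_def[symmetric] by (rule mult_right_le_imp_le)
qed

text \<open>The bimodule property moves \<open>u j\<close> inside \<open>E\<close>, where the
  coefficient \<open>S (u j ** E x)\<close> becomes a pairing in \<open>M\<close> with the relative
  density.\<close>

lemma expectation_expansion:
  assumes E: "op_valued_weight M N E" and x: "x \<in> M"
  shows "E x = (\<Sum>j\<in>J. mat (T (rel_density E ** (u j ** x))) ** mat_star (u j))"
proof -
  have "S (u j ** E x) = T (rel_density E ** (u j ** x))" if j: "j \<in> J" for j
  proof -
    have "u j ** E x = E (u j ** x ** mat 1)"
      using op_valued_weightD(5)[OF E x sub.f_in[OF j], of "mat 1"] sub.alg_closed by simp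
    moreover have "u j ** x \<in> M"
      using x j subset sub.f_in by (intro amb.alg_closed) auto
    ultimately show ?thesis
      using rel_density[OF E, of "u j ** x"] by simp
  qed
  then have "(\<Sum>j\<in>J. mat (T (rel_density E ** (u j ** x))) ** mat_star (u j)) =
      (\<Sum>j\<in>J. mat (S (u j ** E x)) ** mat_star (u j))"
    by simp
  also have "\<dots> = E x"
    by (rule sub.expansion_star[OF op_valued_weightD(1)[OF E x]])
  finally show ?thesis ..
qed

text \<open>A quasi-basis of \<open>E\<close> in Watatani's sense. With
  \<open>expectation_expansion\<close>, the sum over \<open>i\<close> rebuilds
  \<open>y ** rel_density E ** u j\<close>; the density commutes past \<open>u j\<close> and cancels
  \<open>\<rho>\<close>, and \<open>f_fstar\<close> for \<open>N\<close> absorbs the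
  \<open>u j\<close>.\<close>

lemma quasi_basis:
  assumes E: "op_valued_weight M N E" and \<rho>: "\<rho> \<in> M" "rel_density E ** \<rho> = mat 1"
    and k: "rel_density E \<in> commutant N \<inter> M" and y: "y \<in> M"
  shows "(\<Sum>i\<in>I. f i ** \<rho> ** E (mat_star (f i) ** y)) = y"
proof -
  let ?k = "rel_density E"
  have "(\<Sum>i\<in>I. f i ** \<rho> ** E (mat_star (f i) ** y)) =
      (\<Sum>i\<in>I. \<Sum>j\<in>J. mat (T (mat_star (f i) ** (y ** ?k ** u j))) ** f i ** (\<rho> ** mat_star (u j)))"
  proof (rule sum.cong[OF refl])
    fix i assume i: "i \<in> I"
    have "T (?k ** (u j ** (mat_star (f i) ** y))) = T (mat_star (f i) ** (y ** ?k ** u j))" if j: "j \<in> J" for j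
    proof -
      have "T (?k ** u j ** (mat_star (f i) ** y)) = T (mat_star (f i) ** y ** (?k ** u j))"
        using subset i j k y amb.f_in sub.f_in by (intro amb.tracial amb.alg_closed) auto
      then show ?thesis
        by (simp add: matrix_mul_assoc)
    qed
    then have "E (mat_star (f i) ** y) = (\<Sum>j\<in>J. mat (T (mat_star (f i) ** (y ** ?k ** u j))) ** mat_star (u j))"
      using expectation_expansion[OF E, of "mat_star (f i) ** y"] i y amb.alg_closed amb.f_in by simp
    then show "f i ** \<rho> ** E (mat_star (f i) ** y) =
        (\<Sum>j\<in>J. mat (T (mat_star (f i) ** (y ** ?k ** u j))) ** f i ** (\<rho> ** mat_star (u j)))"
      by (simp only: matrix_mult_sum_right mult_mat_left_commute[of "f i ** \<rho>"]) (simp add: matrix_mul_assoc)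
  qed
  also have "\<dots> = (\<Sum>j\<in>J. \<Sum>i\<in>I. mat (T (mat_star (f i) ** (y ** ?k ** u j))) ** f i ** (\<rho> ** mat_star (u j)))"
    by (rule sum.swap)
  also have "\<dots> = (\<Sum>j\<in>J. y ** (u j ** mat_star (u j)))"
  proof (rule sum.cong[OF refl])
    fix j assume j: "j \<in> J"
    have "(\<Sum>i\<in>I. mat (T (mat_star (f i) ** (y ** ?k ** u j))) ** f i) = y ** ?k ** u j"
      using subset j k y sub.f_in by (intro amb.expansion amb.alg_closed) auto
    then have "(\<Sum>i\<in>I. mat (T (mat_star (f i) ** (y ** ?k ** u j))) ** f i ** (\<rho> ** mat_star (u j))) =
        y ** (?k ** u j) ** \<rho> ** mat_star (u j)"
      by (simp add: matrix_mul_assoc flip: matrix_mult_sum_left)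
    also have "\<dots> = y ** u j ** (?k ** \<rho>) ** mat_star (u j)"
      using commutantD[of ?k N "u j"] k j sub.f_in by (simp add: matrix_mul_assoc)
    finally show "(\<Sum>i\<in>I. mat (T (mat_star (f i) ** (y ** ?k ** u j))) ** f i ** (\<rho> ** mat_star (u j))) =
        y ** (u j ** mat_star (u j))"
      by (simp add: \<rho> matrix_mul_assoc)
  qed
  also have "\<dots> = y"
    by (simp add: sub.f_fstar flip: matrix_mult_sum_right)
  finally show ?thesis .
qed

end

section \<open>Markov traces and super-extremality\<close>

lemma left_mult_compose:
  assumes "star_subalgebra M" "y \<in> M"
  shows "left_mult M x \<circ> left_mult M y = left_mult M (x ** y)"
  using star_subalgebraD(3)[OF assms(1,2)]
  by (auto simp: left_mult_def fun_eq_iff matrix_mul_assoc star_subalgebra_0[OF assms(1)])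

lemma trace_on_basic_construction_sum:
  assumes \<tau>1: "trace_on_basic_construction M \<tau> e \<tau>1"
    and g: "\<And>i. i \<in> I \<Longrightarrow> g i \<in> basic_construction M e"
  shows "(\<lambda>y. \<Sum>i\<in>I. g i y) \<in> basic_construction M e \<and> \<tau>1 (\<lambda>y. \<Sum>i\<in>I. g i y) = (\<Sum>i\<in>I. \<tau>1 (g i))"
proof -
  have add: "\<tau>1 (\<lambda>y. A y + B y) = \<tau>1 A + \<tau>1 B"
    if "A \<in> basic_construction M e" "B \<in> basic_construction M e" for A B
    using \<tau>1 that unfolding trace_on_basic_construction_def by blast
  have scale: "\<tau>1 (\<lambda>y. mat 0 ** e y) = 0 * \<tau>1 e"
    using \<tau>1 basic_construction.proj unfolding trace_on_basic_construction_def by blast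
  have zero: "(\<lambda>y. 0) \<in> basic_construction M e" "\<tau>1 (\<lambda>y. 0) = 0"
    using basic_construction.scale[OF basic_construction.proj, where c = 0] scale by simp_all
  show ?thesis
    using g by (induct I rule: infinite_finite_induct) (simp_all add: zero add basic_construction.add)
qed

text \<open>A Markov trace brings its own expectation, which has to be identified with the minimal
  one. The difference \<open>d\<close> of the two values lies in \<open>N\<close>, and pairing with
  \<open>mat_star d\<close> gives \<open>\<tau> (mat_star d ** d) = 0\<close>.\<close>

lemma trace_preserving_expectation_unique:
  assumes N: "star_subalgebra N" and M: "star_subalgebra M" and sub: "N \<subseteq> M"
    and \<tau>: "faithful_functional M \<tau>"
    and E: "trace_preserving_expectation N M \<tau> E" and E': "trace_preserving_expectation N M \<tau> E'"
    and x: "x \<in> M"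
  shows "E x = E' x"
proof -
  have w: "op_valued_weight M N E" "op_valued_weight M N E'"
    using E E' by (auto simp: trace_preserving_expectation_def cond_expectations_def)
  note W = op_valued_weightD[OF w(1)] and W' = op_valued_weightD[OF w(2)]
  note pos = faithful_functional_pos[OF \<tau>]
  define d where "d = E x - E' x"
  have d: "d \<in> N" "mat_star d \<in> N"
    using W(1) W'(1) x star_subalgebra_diff[OF N] star_subalgebraD[OF N] by (auto simp: d_def)
  have bimod: "E (mat_star d ** x) = mat_star d ** E x" "E' (mat_star d ** x) = mat_star d ** E' x"
    using W(5)[OF x d(2), of "mat 1"] W'(5)[OF x d(2), of "mat 1"] star_subalgebraD(1)[OF N] by auto
  have dx: "mat_star d ** x \<in> M" "mat_star d ** E x \<in> M" "mat_star d ** E' x \<in> M"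
    using d(2) W(1)[OF x] W'(1)[OF x] sub x by (auto intro: star_subalgebraD(3)[OF M])
  have "\<tau> (mat_star d ** E x) = \<tau> (mat_star d ** E' x)"
    using E E' dx(1) by (metis bimod trace_preserving_expectation_def)
  then have "\<tau> (mat_star d ** d) = 0"
    using pos_functional_diff[OF pos M dx(2,3)] by (simp add: d_def matrix_diff_ldistrib)
  then have "d = 0"
    using \<tau> d sub unfolding faithful_functional_def by blast
  then show ?thesis
    by (simp add: d_def)
qed

context regular_inclusion
begin

text \<open>
  The quasi-basis gives \<open>1 = \<Sum> f\<^sub>i \<rho> e f\<^sub>i\<^sup>*\<close> in the basic construction, and \<open>avg \<rho> = \<Sum> f\<^sub>i \<rho> f\<^sub>i\<^sup>*\<close>
  is the index.
\<close>

lemma markov_index: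
  assumes E: "op_valued_weight M N E" and \<rho>: "\<rho> \<in> M" "rel_density E ** \<rho> = mat 1"
    and k: "rel_density E \<in> commutant N \<inter> M"
    and \<tau>: "faithful_tracial_state M \<tau>"
    and \<tau>1: "trace_on_basic_construction M \<tau> (jones_projection M E) \<tau>1"
    and left: "\<And>x. x \<in> M \<Longrightarrow> \<tau>1 (left_mult M x) = \<tau> x"
    and markov: "\<And>x. x \<in> M \<Longrightarrow> of_real \<beta> * \<tau>1 (left_mult M x \<circ> jones_projection M E) = \<tau> x"
  shows "amb.avg \<rho> = mat (of_real \<beta>)"
proof -
  let ?e = "jones_projection M E" and ?L = "left_mult M"
  have faith: "faithful_functional M \<tau>"
    and tracial: "\<And>x y. x \<in> M \<Longrightarrow> y \<in> M \<Longrightarrow> \<tau> (x ** y) = \<tau> (y ** x)"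
    using \<tau> by (auto simp: faithful_tracial_state_def faithful_state_def)
  note pos = faithful_functional_pos[OF faith]
  have "\<tau> (x ** (amb.avg \<rho> - mat (of_real \<beta>))) = 0" if x: "x \<in> M" for x
  proof -
    have in_M: "x ** f i ** \<rho> \<in> M" "mat_star (f i) \<in> M" "mat_star (f i) ** (x ** f i ** \<rho>) \<in> M"
      "x ** (f i ** \<rho> ** mat_star (f i)) \<in> M" if "i \<in> I" for i
      by (intro amb.alg_closed amb.f_in x \<rho> that)+
    have E0: "E 0 = 0"
      using op_valued_weightD(3)[OF E star_subalgebra_0[OF amb.alg], of 0] by simp
    \<comment> \<open>The quasi-basis inserted behind \<open>x\<close>. Outside \<open>M\<close> the
      left side is 0 by convention, and \<open>E0\<close> makes the right side agree.\<close>
    have "?L x = (\<lambda>y. \<Sum>i\<in>I. (?L (x ** f i ** \<rho>) \<circ> ?e \<circ> ?L (mat_star (f i))) y)"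
    proof
      fix y
      show "?L x y = (\<Sum>i\<in>I. (?L (x ** f i ** \<rho>) \<circ> ?e \<circ> ?L (mat_star (f i))) y)"
      proof (cases "y \<in> M")
        case True
        have "(?L (x ** f i ** \<rho>) \<circ> ?e \<circ> ?L (mat_star (f i))) y = x ** (f i ** \<rho> ** E (mat_star (f i) ** y))"
          if "i \<in> I" for i
        proof -
          have "mat_star (f i) ** y \<in> M"
            by (intro amb.alg_closed amb.f_in True that)
          moreover from this have "E (mat_star (f i) ** y) \<in> M"
            using op_valued_weightD(1)[OF E] subset by blast
          ultimately show ?thesis
            using True by (simp add: left_mult_def jones_projection_def matrix_mul_assoc)
        qed
        then have "(\<Sum>i\<in>I. (?L (x ** f i ** \<rho>) \<circ> ?e \<circ> ?L (mat_star (f i))) y) = x ** y"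
          using quasi_basis[OF E \<rho> k True] by (simp flip: matrix_mult_sum_right)
        then show ?thesis
          using True by (simp add: left_mult_def)
      next
        case False
        then show ?thesis
          by (simp add: left_mult_def jones_projection_def E0 star_subalgebra_0[OF amb.alg])
      qed
    qed
    then have "\<tau> x = \<tau>1 (\<lambda>y. \<Sum>i\<in>I. (?L (x ** f i ** \<rho>) \<circ> ?e \<circ> ?L (mat_star (f i))) y)"
      using left[OF x] by simp
    also have "\<dots> = (\<Sum>i\<in>I. \<tau>1 (?L (x ** f i ** \<rho>) \<circ> ?e \<circ> ?L (mat_star (f i))))"
      by (intro trace_on_basic_construction_sum[OF \<tau>1, THEN conjunct2] basic_construction.intros in_M)
    also have "of_real \<beta> * \<dots> = (\<Sum>i\<in>I. \<tau> (x ** (f i ** \<rho> ** mat_star (f i))))"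
      unfolding sum_distrib_left
    proof (rule sum.cong[OF refl])
      fix i assume i: "i \<in> I"
      have "?L (x ** f i ** \<rho>) \<circ> ?e \<in> basic_construction M ?e" "?L (mat_star (f i)) \<in> basic_construction M ?e"
        by (intro basic_construction.intros in_M i)+
      \<comment> \<open>The trace property carries the last factor to the front, leaving a left
        multiplication followed by the Jones projection, as in the Markov condition.\<close>
      then have "\<tau>1 (?L (x ** f i ** \<rho>) \<circ> ?e \<circ> ?L (mat_star (f i))) =
          \<tau>1 (?L (mat_star (f i)) \<circ> (?L (x ** f i ** \<rho>) \<circ> ?e))"
        using \<tau>1 unfolding trace_on_basic_construction_def by blast
      also have "?L (mat_star (f i)) \<circ> (?L (x ** f i ** \<rho>) \<circ> ?e) = ?L (mat_star (f i) ** (x ** f i ** \<rho>)) \<circ> ?e"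
        using left_mult_compose[OF amb.alg in_M(1)[OF i]] by (simp add: o_assoc)
      finally have "of_real \<beta> * \<tau>1 (?L (x ** f i ** \<rho>) \<circ> ?e \<circ> ?L (mat_star (f i))) =
          \<tau> (mat_star (f i) ** (x ** f i ** \<rho>))"
        using markov[OF in_M(3)[OF i]] by (simp only:)
      also have "\<dots> = \<tau> (x ** f i ** \<rho> ** mat_star (f i))"
        by (intro tracial in_M i)
      finally show "of_real \<beta> * \<tau>1 (?L (x ** f i ** \<rho>) \<circ> ?e \<circ> ?L (mat_star (f i))) =
          \<tau> (x ** (f i ** \<rho> ** mat_star (f i)))"
        by (simp add: matrix_mul_assoc)
    qed
    also have "\<dots> = \<tau> (x ** amb.avg \<rho>)"
      unfolding amb.avg_def matrix_mult_sum_right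
      by (intro pos_functional_sum[OF pos amb.alg, symmetric] in_M)
    finally have "\<tau> (x ** amb.avg \<rho>) = of_real \<beta> * \<tau> x" ..
    also have "\<dots> = \<tau> (x ** mat (of_real \<beta>))"
      using pos_functionalD(2)[OF pos x] by (simp add: mat_central[of x])
    finally show ?thesis
      using pos_functional_diff[OF pos amb.alg, of "x ** amb.avg \<rho>" "x ** mat (of_real \<beta>)"] x
        amb.alg_closed amb.avg_in[OF \<rho>(1)] by (simp add: matrix_diff_ldistrib)
  qed
  then have "amb.avg \<rho> - mat (of_real \<beta>) = 0"
    by (intro faithful_functional_nondegenerate[OF faith amb.alg] amb.alg_closed amb.avg_in \<rho>) auto
  then show ?thesis
    by simp
qed

text \<open>The Markov property fixes only the average of \<open>\<rho>\<close>. As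
  \<open>\<tau>\<close> is invariant under averaging, the condition
  \<open>\<tau> \<circ> E' = \<tau>\<close> becomes
  \<open>\<tau> (\<rho> ** x) = \<beta> * \<tau> x\<close> on the relative commutant, which contains
  \<open>\<rho>\<close>; faithfulness of \<open>\<tau>\<close> then yields
  \<open>\<rho> = \<beta>\<close> itself.\<close>

lemma super_extremal_structure:
  assumes "super_extremal N M"
  obtains E F where "E \<in> cond_expectations M N" "kosaki_inverse N M E F"
    "min_index N M = Re (T (mat 1)) / Re (S (mat 1))"
    "\<And>x. x \<in> M \<Longrightarrow> S (E x) = of_real (Re (S (mat 1)) / Re (T (mat 1))) * T x"
    "\<And>x. x \<in> commutant N \<Longrightarrow> F x = mat (of_real (Re (T (mat 1)) / Re (S (mat 1)))) ** amb.avg x"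
proof -
  obtain \<tau> E \<omega> where min: "minimal_expectation N M E" and E_\<tau>: "trace_preserving_expectation N M \<tau> E"
    and markov: "normalized_markov_trace N M \<tau>" and spherical: "spherical_state N M E \<omega>"
    and \<omega>_\<tau>: "\<And>x. x \<in> commutant N \<inter> M \<Longrightarrow> \<omega> x = \<tau> x"
    using assms unfolding super_extremal_def extremal_via_def by blast
  have E: "E \<in> cond_expectations M N" "op_valued_weight M N E" "E (mat 1) = mat 1"
    using E_\<tau> by (auto simp: trace_preserving_expectation_def cond_expectations_def)
  obtain F where F: "kosaki_inverse N M E F" "op_norm (F (mat 1)) = min_index N M"
    using min unfolding minimal_expectation_def has_index_def by blast
  obtain F' E' where F': "kosaki_inverse N M E F'"
    and E': "\<And>x. x \<in> commutant N \<Longrightarrow> E' x = matrix_inv (F' (mat 1)) ** F' x"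
    and \<omega>_E': "\<And>x. x \<in> commutant N \<inter> M \<Longrightarrow> \<omega> x = \<omega> (E' x)"
    using spherical unfolding spherical_state_def dual_expectation_def by blast
  obtain \<beta> E1 \<tau>1 where \<tau>: "faithful_tracial_state M \<tau>" and E1: "trace_preserving_expectation N M \<tau> E1"
    and \<tau>1: "trace_on_basic_construction M \<tau> (jones_projection M E1) \<tau>1"
    and left: "\<And>x. x \<in> M \<Longrightarrow> \<tau>1 (left_mult M x) = \<tau> x"
    and mod: "\<And>x. x \<in> M \<Longrightarrow> of_real \<beta> * \<tau>1 (left_mult M x \<circ> jones_projection M E1) = \<tau> x"
    using markov unfolding normalized_markov_trace_def markov_trace_of_modulus_def by blast
  have faith: "faithful_functional M \<tau>"
    and tracial: "\<And>x y. x \<in> M \<Longrightarrow> y \<in> M \<Longrightarrow> \<tau> (x ** y) = \<tau> (y ** x)"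
    using \<tau> by (auto simp: faithful_tracial_state_def faithful_state_def)
  note pos = faithful_functional_pos[OF faith]
  have jones: "jones_projection M E1 = jones_projection M E"
    using trace_preserving_expectation_unique[OF sub.alg amb.alg subset faith E1 E_\<tau>]
    by (auto simp: jones_projection_def)
  let ?k = "rel_density E"
  obtain \<rho> where \<rho>: "\<rho> \<in> commutant N \<inter> M" "?k ** \<rho> = mat 1" "\<rho> ** ?k = mat 1"
    and k: "?k \<in> commutant N \<inter> M"
    and F_eq: "\<And>x. x \<in> commutant N \<Longrightarrow> F x = amb.avg (\<rho> ** x)"
    using kosaki_structure[OF E(2) F(1)] by metis
  obtain \<rho>' where \<rho>': "?k ** \<rho>' = mat 1" "\<And>x. x \<in> commutant N \<Longrightarrow> F' x = amb.avg (\<rho>' ** x)"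
    using kosaki_structure[OF E(2) F'] by metis
  \<comment> \<open>The minimal and the dual expectation each provide a Kosaki inverse,
    \<open>F\<close> and \<open>F'\<close>; both are governed by the inverse of the same
    density.\<close>
  have "\<rho>' = \<rho> ** ?k ** \<rho>'"
    using \<rho> by simp
  then have "\<rho>' = \<rho>"
    using \<rho>'(1) by (simp flip: matrix_mul_assoc)
  then have F'_eq: "F' x = amb.avg (\<rho> ** x)" if "x \<in> commutant N" for x
    using \<rho>'(2) that by simp
  have one: "mat 1 \<in> commutant N"
    by (rule star_subalgebraD(1)[OF sub.alg_commutant])
  have index: "amb.avg \<rho> = mat (of_real \<beta>)"
    using markov_index[OF E(2) _ \<rho>(2) k \<tau> _ left mod[unfolded jones]] \<tau>1 \<rho>(1) unfolding jones by blast
  then have F'_1: "F' (mat 1) = mat (of_real \<beta>)"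
    using F'_eq[OF one] by simp
  \<comment> \<open>The modulus is an arbitrary real by definition; zero would give
    \<open>F' (mat 1) = 0\<close>, against the faithfulness of \<open>F'\<close>.\<close>
  have "\<beta> \<noteq> 0"
  proof
    assume "\<beta> = 0"
    then have "F' (mat_star (mat 1) ** mat 1) = 0"
      using F'_1 by simp
    then have "(mat 1 :: 'n cmat) = 0"
      using F' one unfolding kosaki_inverse_def op_valued_weight_def by blast
    then show False
      using amb.T_1_pos(1) amb.T_scale[of 0 0] by simp
  qed
  have inv: "matrix_inv (F' (mat 1)) = mat (of_real (1 / \<beta>))"
  proof -
    have "mat (of_real \<beta>) ** mat (of_real (1 / \<beta>)) = (mat 1 :: 'n cmat)"
      "mat (of_real (1 / \<beta>)) ** mat (of_real \<beta>) = (mat 1 :: 'n cmat)"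
      using \<open>\<beta> \<noteq> 0\<close> by (simp_all add: mat_mult)
    then show ?thesis
      unfolding F'_1 by (rule matrix_inv_unique)
  qed
  \<comment> \<open>The deviation of \<open>\<rho>\<close> from the scalar \<open>\<beta>\<close>,
    up to a factor. It lies in the relative commutant, so its adjoint is an admissible test element
    below.\<close>
  define d where "d = mat (of_real (1 / \<beta>)) ** \<rho> - mat 1"
  have d: "d \<in> commutant N \<inter> M"
    unfolding d_def by (intro relative_commutant_closed \<rho>)
  have "\<tau> (d ** x) = 0" if x: "x \<in> commutant N \<inter> M" for x
  proof -
    have \<rho>x: "\<rho> ** x \<in> commutant N \<inter> M"
      by (intro relative_commutant_closed \<rho> x)
    have avg: "amb.avg (\<rho> ** x) \<in> commutant N \<inter> M"
      using amb.avg_in[of "\<rho> ** x"] amb.avg_commutant[of "\<rho> ** x"] commutant_subset \<rho>x by auto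
    have E'x: "E' x = mat (of_real (1 / \<beta>)) ** amb.avg (\<rho> ** x)"
      using E' F'_eq x inv by simp
    have "\<tau> x = \<tau> (E' x)"
      using \<omega>_\<tau>[OF x] \<omega>_E'[OF x] \<omega>_\<tau>[of "E' x"] relative_commutant_closed(3)[OF avg] E'x by simp
    also have "\<dots> = of_real (1 / \<beta>) * \<tau> (amb.avg (\<rho> ** x))"
      unfolding E'x using avg by (intro pos_functionalD(2)[OF pos]) auto
    also have "\<dots> = of_real (1 / \<beta>) * \<tau> (\<rho> ** x)"
      using amb.T_avg[OF pos tracial, of "\<rho> ** x"] \<rho>x by simp
    also have "\<dots> = \<tau> (mat (of_real (1 / \<beta>)) ** (\<rho> ** x))"
      using pos_functionalD(2)[OF pos, of "\<rho> ** x" "of_real (1 / \<beta>)"] \<rho>x by simp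
    finally have "\<tau> (mat (of_real (1 / \<beta>)) ** (\<rho> ** x) - x) = 0"
      using pos_functional_diff[OF pos amb.alg, of "mat (of_real (1 / \<beta>)) ** (\<rho> ** x)" x]
        relative_commutant_closed(3)[OF \<rho>x] x by simp
    then show ?thesis
      by (simp add: d_def matrix_diff_rdistrib matrix_mul_assoc)
  qed
  from this[OF relative_commutant_closed(4)[OF d]] have "\<tau> (mat_star (mat_star d) ** mat_star d) = 0"
    by simp
  moreover have "mat_star d \<in> M"
    using relative_commutant_closed(4)[OF d] by simp
  ultimately have "mat_star d = 0"
    using faith unfolding faithful_functional_def by blast
  then have "d = 0"
    by simp
  then have "mat (of_real \<beta>) ** (mat (of_real (1 / \<beta>)) ** \<rho>) = mat (of_real \<beta>)"
    by (simp add: d_def)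
  then have \<rho>_eq: "\<rho> = mat (of_real \<beta>)"
    using \<open>\<beta> \<noteq> 0\<close> by (simp add: matrix_mul_assoc mat_mult)
  have "mat (of_real (1 / \<beta>)) ** (\<rho> ** ?k) = mat (of_real (1 / \<beta>))"
    using \<rho>(3) by simp
  then have k_eq: "?k = mat (of_real (1 / \<beta>))"
    using \<open>\<beta> \<noteq> 0\<close> by (simp add: \<rho>_eq matrix_mul_assoc mat_mult)
  have S_E: "S (E x) = of_real (1 / \<beta>) * T x" if "x \<in> M" for x
    using rel_density[OF E(2) that] by (simp add: k_eq amb.T_scale)
  have "Re (S (mat 1)) = 1 / \<beta> * Re (T (mat 1))"
    using arg_cong[OF S_E[of "mat 1"], of Re] E(3) amb.alg_closed by simp
  then have \<beta>: "\<beta> = Re (T (mat 1)) / Re (S (mat 1))"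
    using sub.T_1_pos(1) \<open>\<beta> \<noteq> 0\<close> by (simp add: field_simps)
  then have "\<beta> > 0"
    using sub.T_1_pos(1) amb.T_1_pos(1) by simp
  have "F (mat 1) = mat (of_real \<beta>)"
    using F_eq[OF one] index by simp
  then have "min_index N M = \<beta>"
    using F(2) \<open>\<beta> > 0\<close> by (simp add: op_norm_mat)
  moreover have "F x = mat (of_real \<beta>) ** amb.avg x" if "x \<in> commutant N" for x
    using F_eq[OF that] by (simp add: \<rho>_eq amb.avg_scale)
  moreover have "1 / \<beta> = Re (S (mat 1)) / Re (T (mat 1))"
    using \<beta> by simp
  ultimately show ?thesis
    using that[OF E(1) F(1)] S_E \<beta> by metis
qed

section \<open>Composition of expectations and of Kosaki inverses\<close>

lemma density_compose_scaled_expectation: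
  assumes G: "\<And>x. x \<in> M \<Longrightarrow> G x \<in> N" "\<And>x b. x \<in> M \<Longrightarrow> b \<in> N \<Longrightarrow> G (b ** x) = b ** G x"
    and S_G: "\<And>x. x \<in> M \<Longrightarrow> S (G x) = of_real c * T x"
    and \<phi>: "pos_functional N \<phi>" and x: "x \<in> M"
  shows "\<phi> (G (mat_star x ** x)) = of_real c * T (x ** sub.density \<phi> ** mat_star x)"
proof -
  let ?h = "sub.density \<phi>"
  have h: "?h \<in> N" "?h \<in> M"
    using sub.density_in subset by auto
  have xx: "mat_star x ** x \<in> M" "?h ** (mat_star x ** x) \<in> M"
    by (intro amb.alg_closed x h)+
  have "\<phi> (G (mat_star x ** x)) = S (?h ** G (mat_star x ** x))"
    by (rule sub.density[OF \<phi> G(1)[OF xx(1)]])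
  also have "\<dots> = of_real c * T (?h ** (mat_star x ** x))"
    using S_G[OF xx(2)] G(2)[OF xx(1) h(1)] by simp
  \<comment> \<open>Traciality surrounds the density by \<open>x\<close> and its adjoint, a form in
    which its positivity is inherited.\<close>
  also have "T (?h ** mat_star x ** x) = T (x ** (?h ** mat_star x))"
    by (intro amb.tracial amb.alg_closed x h)
  then have "T (?h ** (mat_star x ** x)) = T (x ** ?h ** mat_star x)"
    by (simp add: matrix_mul_assoc)
  finally show ?thesis .
qed

text \<open>
  Positivity of \<open>G\<close> comes from \<open>\<phi>(G(x\<^sup>* x)) = c T(x h x\<^sup>*)\<close>, where the density \<open>h\<close> of a positive
  functional \<open>\<phi>\<close> is positive semidefinite; take for \<open>\<phi>\<close> the vector functionals.
\<close>

lemma scaled_expectation: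
  assumes G: "\<And>x. x \<in> M \<Longrightarrow> G x \<in> N" "\<And>x y. x \<in> M \<Longrightarrow> y \<in> M \<Longrightarrow> G (x + y) = G x + G y"
    "\<And>x a. x \<in> M \<Longrightarrow> G (mat a ** x) = mat a ** G x"
    "\<And>x b b'. x \<in> M \<Longrightarrow> b \<in> N \<Longrightarrow> b' \<in> N \<Longrightarrow> G (b ** x ** b') = b ** G x ** b'"
    and S_G: "\<And>x. x \<in> M \<Longrightarrow> S (G x) = of_real c * T x" and c: "c > 0"
  shows "op_valued_weight M N G"
    and "faithful_functional N \<phi> \<Longrightarrow> faithful_functional M (\<phi> \<circ> G)"
proof -
  have left: "G (b ** x) = b ** G x" if "x \<in> M" "b \<in> N" for x b
    using G(4)[OF that, of "mat 1"] sub.alg_closed by simp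
  have compose: "\<phi> (G (mat_star x ** x)) = of_real c * T (x ** sub.density \<phi> ** mat_star x)"
    if "pos_functional N \<phi>" "x \<in> M" for \<phi> x
    by (rule density_compose_scaled_expectation[OF G(1) left S_G that])
  have h: "psd (sub.density \<phi>)" if "pos_functional N \<phi>" for \<phi>
    by (rule density_psd[OF sub.alg sub.T_faithful_functional[OF subset_refl] sub.tracial sub.density_in
          that sub.density[OF that]])
  have nonneg: "\<phi> (G (mat_star x ** x)) \<in> \<real>\<^sub>\<ge>\<^sub>0" if "pos_functional N \<phi>" "x \<in> M" for \<phi> x
    unfolding compose[OF that] using c
    by (intro nonneg_Reals_mult_I amb.T_psd psd_conj h that) simp
  show "op_valued_weight M N G"
    unfolding op_valued_weight_def
  proof (intro conjI ballI allI impI)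
    fix x assume x: "x \<in> M"
    show "psd (G (mat_star x ** x))"
      unfolding psd_def
    proof
      fix \<xi>
      have "pos_functional N (\<lambda>y. cinner \<xi> (y *v \<xi>))"
      proof -
        have "cinner \<xi> ((mat_star y ** y) *v \<xi>) \<in> \<real>\<^sub>\<ge>\<^sub>0" for y
          using psd_mult_star[of "mat_star y"] by (simp add: psd_def)
        then show ?thesis
          by (simp add: pos_functional_def matrix_vector_mult_add_rdistrib cinner_add_right
              mat_mult_vec cinner_scale_right flip: matrix_vector_mul_assoc)
      qed
      from nonneg[OF this x] show "cinner \<xi> (G (mat_star x ** x) *v \<xi>) \<in> \<real>\<^sub>\<ge>\<^sub>0" .
    qed
    assume "G (mat_star x ** x) = 0"
    moreover have "mat_star x ** x \<in> M"
      by (intro amb.alg_closed x)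
    ultimately have "of_real c * T (mat_star x ** x) = S 0"
      using S_G by metis
    then have "T (mat_star x ** x) = 0"
      using c sub.T_scale[of 0 0] by simp
    then show "x = 0"
      by (rule amb.T_faithful)
  qed (use G in auto)
  assume \<phi>: "faithful_functional N \<phi>"
  note pos = faithful_functional_pos[OF \<phi>]
  let ?h = "sub.density \<phi>"
  obtain l where l: "mat_star ?h = ?h" "l > 0" "\<And>w. Re (cinner w (?h *v w)) \<ge> l * (norm w)\<^sup>2"
    using density_lower_bound[OF sub.alg sub.T_faithful_functional[OF subset_refl] sub.tracial sub.density_in
          pos sub.density[OF pos]] \<phi> by metis
  have psd: "psd (?h - mat (of_real l))"
    unfolding psd_iff using l
    by (auto simp: matrix_vector_mult_diff_rdistrib mat_mult_vec cinner_diff_right cinner_scale_right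
        cinner_self simp del: of_real_power)
  have "x = 0" if x: "x \<in> M" and 0: "\<phi> (G (mat_star x ** x)) = 0" for x
  proof -
    have "T (x ** ?h ** mat_star x) = 0"
      using 0 compose[OF pos x] c by simp
    also have "x ** ?h ** mat_star x = x ** (?h - mat (of_real l)) ** mat_star x + mat (of_real l) ** (x ** mat_star x)"
      by (simp add: matrix_diff_ldistrib matrix_diff_rdistrib mat_central[of x] matrix_mul_assoc)
    finally have "Re (T (x ** (?h - mat (of_real l)) ** mat_star x)) + l * Re (T (x ** mat_star x)) = 0"
      by (simp add: amb.T_add amb.T_scale complex_eq_iff)
    moreover have "T (x ** (?h - mat (of_real l)) ** mat_star x) \<in> \<real>\<^sub>\<ge>\<^sub>0" "T (x ** mat_star x) \<in> \<real>\<^sub>\<ge>\<^sub>0"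
      by (intro amb.T_psd psd_conj psd psd_mult_star)+
    ultimately have "T (mat_star (mat_star x) ** mat_star x) = 0"
      using l(2) by (simp add: complex_nonneg_Reals_iff complex_eq_iff) (smt (verit) mult_pos_pos)
    then have "mat_star x = 0"
      by (rule amb.T_faithful)
    then show ?thesis
      by simp
  qed
  then show "faithful_functional M (\<phi> \<circ> G)"
    unfolding faithful_functional_def pos_functional_def
    using G(1-3) nonneg[OF pos] pos_functionalD[OF pos] by auto
qed

end

text \<open>The relation for \<open>E2\<close> is taken at \<open>\<phi> \<circ> E1\<close> and the
  one for \<open>E1\<close> at \<open>\<psi> \<circ> F2\<close>; they meet in a spatial derivative
  over \<open>commutant N\<close>. Both speak of faithful functionals only, whence the last two
  hypotheses.\<close>

lemma kosaki_inverse_compose: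
  assumes kos: "kosaki_inverse L N E1 F1" "kosaki_inverse N M E2 F2"
    and weight: "op_valued_weight (commutant L) (commutant M) (F2 \<circ> F1)"
    and E1: "\<And>\<phi>. faithful_functional L \<phi> \<Longrightarrow> faithful_functional N (\<phi> \<circ> E1)"
    and F2: "\<And>\<psi>. faithful_functional (commutant M) \<psi> \<Longrightarrow> faithful_functional (commutant N) (\<psi> \<circ> F2)"
  shows "kosaki_inverse L M (E1 \<circ> E2) (F2 \<circ> F1)"
  unfolding kosaki_inverse_def
proof (intro conjI allI impI weight)
  fix \<phi> \<psi> assume \<phi>: "faithful_functional L \<phi>" and \<psi>: "faithful_functional (commutant M) \<psi>"
  have "spatial_derivative (commutant M) ((\<phi> \<circ> E1) \<circ> E2) \<psi> = spatial_derivative (commutant N) (\<phi> \<circ> E1) (\<psi> \<circ> F2)"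
    using kos(2) E1[OF \<phi>] \<psi> unfolding kosaki_inverse_def by blast
  also have "\<dots> = spatial_derivative (commutant L) \<phi> ((\<psi> \<circ> F2) \<circ> F1)"
    using kos(1) \<phi> F2[OF \<psi>] unfolding kosaki_inverse_def by blast
  finally show "spatial_derivative (commutant M) (\<phi> \<circ> (E1 \<circ> E2)) \<psi> =
      spatial_derivative (commutant L) \<phi> (\<psi> \<circ> (F2 \<circ> F1))"
    by (simp add: o_assoc)
qed

theorem proposition3p3:
  fixes L N M :: "(complex^'n^'n) set"
  assumes "multi_matrix_algebra L" and "multi_matrix_algebra N" and "multi_matrix_algebra M"
    and "L \<subseteq> N" and "N \<subseteq> M"
    and "connected_inclusion L N" and "connected_inclusion N M"
    and "super_extremal L N" and "super_extremal N M"
  shows "min_index L M = min_index L N * min_index N M \<and>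
         scalar_dimension L M = scalar_dimension L N * scalar_dimension N M"
proof -
  obtain K :: "(nat \<times> nat \<times> nat) set" and w R where L: "regular_trace L K w R"
    using multi_matrix_algebra_regular_trace[OF assms(1)] .
  obtain J :: "(nat \<times> nat \<times> nat) set" and u S where N: "regular_trace N J u S"
    using multi_matrix_algebra_regular_trace[OF assms(2)] .
  obtain I :: "(nat \<times> nat \<times> nat) set" and f T where M: "regular_trace M I f T"
    using multi_matrix_algebra_regular_trace[OF assms(3)] .
  interpret L: regular_trace L K w R by (rule L)
  interpret N: regular_trace N J u S by (rule N)
  interpret M: regular_trace M I f T by (rule M)
  interpret LN: regular_inclusion L K w R N J u S
    by (intro regular_inclusion.intro L N regular_inclusion_axioms.intro assms)
  interpret NM: regular_inclusion N J u S M I f T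
    by (intro regular_inclusion.intro N M regular_inclusion_axioms.intro assms)
  interpret LM: regular_inclusion L K w R M I f T
    using assms(4,5) by (intro regular_inclusion.intro L M regular_inclusion_axioms.intro) auto
  \<comment> \<open>The dimensions of \<open>L\<close>, \<open>N\<close> and
    \<open>M\<close>.\<close>
  define r s t where "r = Re (R (mat 1))" and "s = Re (S (mat 1))" and "t = Re (T (mat 1))"
  have pos: "r > 0" "s > 0" "t > 0"
    using L.T_1_pos N.T_1_pos M.T_1_pos by (auto simp: r_def s_def t_def)
  obtain E1 F1 where E1: "E1 \<in> cond_expectations N L" and F1: "kosaki_inverse L N E1 F1"
    and ind1: "min_index L N = s / r"
    and R_E1: "\<And>x. x \<in> N \<Longrightarrow> R (E1 x) = of_real (r / s) * S x"
    and F1_eq: "\<And>x. x \<in> commutant L \<Longrightarrow> F1 x = mat (of_real (s / r)) ** N.avg x"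
    using LN.super_extremal_structure[OF assms(8)] unfolding r_def s_def by metis
  obtain E2 F2 where E2: "E2 \<in> cond_expectations M N" and F2: "kosaki_inverse N M E2 F2"
    and ind2: "min_index N M = t / s"
    and S_E2: "\<And>x. x \<in> M \<Longrightarrow> S (E2 x) = of_real (s / t) * T x"
    and F2_eq: "\<And>x. x \<in> commutant N \<Longrightarrow> F2 x = mat (of_real (t / s)) ** M.avg x"
    using NM.super_extremal_structure[OF assms(9)] unfolding s_def t_def by metis
  have W: "op_valued_weight N L E1" "op_valued_weight M N E2" and unital: "E1 (mat 1) = mat 1" "E2 (mat 1) = mat 1"
    using E1 E2 by (auto simp: cond_expectations_def)
  have V: "op_valued_weight (commutant L) (commutant N) F1" "op_valued_weight (commutant N) (commutant M) F2"
    using F1 F2 by (auto simp: kosaki_inverse_def)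
  note W1 = op_valued_weightD[OF W(1)] and W2 = op_valued_weightD[OF W(2)]
    and V1 = op_valued_weightD[OF V(1)] and V2 = op_valued_weightD[OF V(2)]
  \<comment> \<open>\<open>E1\<close> is known to be positive only on products
    \<open>mat_star y ** y\<close> with \<open>y\<close> in \<open>N\<close>, and
    \<open>E2 (mat_star x ** x)\<close> is not exhibited in this form. Positivity of the composite
    therefore comes from its scalar density \<open>r / t\<close>.\<close>
  have E_weight: "op_valued_weight M L (E1 \<circ> E2)"
  proof (rule LM.scaled_expectation(1)[where c = "r / t"])
    show "R ((E1 \<circ> E2) x) = of_real (r / t) * T x" if "x \<in> M" for x
      using R_E1[OF W2(1)[OF that]] S_E2[OF that] pos by simp
    show "(E1 \<circ> E2) (b ** x ** b') = b ** (E1 \<circ> E2) x ** b'" if "x \<in> M" "b \<in> L" "b' \<in> L" for x b b'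
      using that W1(5) W2(1,5) assms(4) by (simp add: subset_iff)
  qed (use W1(1-3) W2(1-3) pos in auto)
  then have E: "E1 \<circ> E2 \<in> cond_expectations M L"
    using unital by (simp add: cond_expectations_def)
  have F_eq: "F2 (F1 x) = mat (of_real (t / r)) ** M.avg (N.avg x)" if "x \<in> commutant L" for x
    using F2_eq[OF V1(1)[OF that]] F1_eq[OF that] pos
    by (simp add: M.avg_scale matrix_mul_assoc mat_mult)
  \<comment> \<open>The same obstacle for \<open>F2 \<circ> F1\<close>. Here the averages are
    positive on all positive semidefinite matrices, and they preserve the trace, which gives
    faithfulness.\<close>
  have F_weight: "op_valued_weight (commutant L) (commutant M) (F2 \<circ> F1)"
    unfolding op_valued_weight_def
  proof (intro conjI ballI allI impI)
    fix x assume x: "x \<in> commutant L"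
    have xx: "mat_star x ** x \<in> commutant L"
      by (intro star_subalgebraD[OF L.alg_commutant] x)
    have psd: "psd (mat_star x ** x)"
      using psd_mult_star[of "mat_star x"] by simp
    show "psd ((F2 \<circ> F1) (mat_star x ** x))"
      unfolding o_apply F_eq[OF xx]
      using pos by (intro psd_scale M.avg_psd N.avg_psd psd) simp
    assume "(F2 \<circ> F1) (mat_star x ** x) = 0"
    then have "trace (mat (of_real (t / r)) ** M.avg (N.avg (mat_star x ** x))) = 0"
      unfolding o_apply F_eq[OF xx] by (simp only: trace_zero)
    then have "trace (M.avg (N.avg (mat_star x ** x))) = 0"
      using pos by (simp add: trace_scale)
    moreover have "trace (M.avg y) = trace y" "trace (N.avg y) = trace y" for y
      using M.trace_avg_mult[of "mat 1" y] N.trace_avg_mult[of "mat 1" y]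
        star_subalgebraD(1)[OF M.alg_commutant] star_subalgebraD(1)[OF N.alg_commutant] by auto
    ultimately show "x = 0"
      by (simp add: trace_star_mult_self_eq_0)
  next
    fix x b b' assume "x \<in> commutant L" "b \<in> commutant M" "b' \<in> commutant M"
    then show "(F2 \<circ> F1) (b ** x ** b') = b ** (F2 \<circ> F1) x ** b'"
      using V1(1,5) V2(5) NM.commutant_subset by (simp add: subset_iff)
  qed (use V1(1-3) V2(1-3) in auto)
  have "kosaki_inverse L M (E1 \<circ> E2) (F2 \<circ> F1)"
  proof (rule kosaki_inverse_compose[OF F1 F2 F_weight])
    show "faithful_functional N (\<phi> \<circ> E1)" if "faithful_functional L \<phi>" for \<phi>
      using W1(1-3,5) R_E1 pos that by (intro LN.scaled_expectation(2)[where c = "r / s"]) auto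
    show "faithful_functional (commutant N) (\<psi> \<circ> F2)" if \<psi>: "faithful_functional (commutant M) \<psi>" for \<psi>
    proof -
      have avg: "faithful_functional UNIV (\<psi> \<circ> M.avg)"
        by (rule M.faithful_functional_compose_avg[OF \<psi>])
      have eq: "(\<psi> \<circ> F2) x = of_real (t / s) * (\<psi> \<circ> M.avg) x" if "x \<in> commutant N" for x
        using F2_eq[OF that] pos_functionalD(2)[OF faithful_functional_pos[OF \<psi>] M.avg_commutant]
        by simp
      have closed: "x + y \<in> commutant N" "x ** y \<in> commutant N" "mat c ** x \<in> commutant N" "mat_star x \<in> commutant N"
        if "x \<in> commutant N" "y \<in> commutant N" for x y c
        by (intro star_subalgebraD[OF N.alg_commutant] that)+
      show ?thesis
        using avg pos unfolding faithful_functional_def pos_functional_def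
        by (auto simp: eq closed distrib_left intro!: nonneg_Reals_mult_I simp del: o_apply of_real_divide)
    qed
  qed
  moreover have "(F2 \<circ> F1) (mat 1) = mat (of_real (t / r))"
    using F_eq[of "mat 1"] N.avg_fixes[of "mat 1"] M.avg_fixes[of "mat 1"]
      star_subalgebraD(1)[OF L.alg_commutant] star_subalgebraD(1)[OF N.alg_commutant]
      star_subalgebraD(1)[OF M.alg_commutant] by simp
  ultimately have index: "has_index L M (E1 \<circ> E2) (mat (of_real (t / r)))"
    unfolding has_index_def by metis
  have "min_index L M = t / r"
    unfolding min_index_def
  proof (rule Least_equality)
    have "op_norm (mat (complex_of_real (t / r)) :: 'n cmat) = t / r"
      using pos by (simp add: op_norm_mat norm_divide)
    then show "\<exists>E\<in>cond_expectations M L. \<exists>X. has_index L M E X \<and> t / r = op_norm X"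
      using E index by metis
    show "t / r \<le> q" if "\<exists>E\<in>cond_expectations M L. \<exists>X. has_index L M E X \<and> q = op_norm X" for q
      using that LM.index_lower_bound unfolding has_index_def r_def t_def by blast
  qed
  then have "min_index L M = min_index L N * min_index N M"
    using ind1 ind2 pos by simp
  then show ?thesis
    by (simp add: scalar_dimension_def real_sqrt_mult)
qed

end
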